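(* For every limit sketch $(E,A,\{C_\alpha\}_{\alpha\in A})$, the unit map $L_E(!):E\to\mathrm{Fr}(E)$, i.e. the morphism of limit sketches $(L_E(!),\mathrm{id}_A):(E,A,\{C_\alpha\})\to(\mathrm{Fib}_E(!),A,\{L_E(!)(C_\alpha)\})$, is a Morita equivalence.
   Context: **Limit sketches.** A cone $C=(x,I,\phi,\delta)$ in a category $E$ consists of an object $x$ of $E$ (the vertex), a small category $I$, a functor $\phi:I\to E$, and a natural transformation $\delta:*_x\Rightarrow\phi$, where $*_x:I\to E$ is the constant functor at $x$. A functor $F:E\to E'$ sends it to the cone $F(C)=(F(x),I,F\circ\phi,F\delta)$. A limit sketch $(E,A,\{C_\alpha\}_{\alpha\in A})$ is a small category $E$ with a set of cones $C_\alpha=(x_\alpha,I_\alpha,\phi_\alpha,\delta_\alpha)$ in $E$ indexed by a set $A$. A morphism $(E,A,\{C_\alpha\})\to(E',B,\{C'_\beta\})$ is a pair $(F,f)$ of a functor $F:E\to E'$ and a function $f:A\to B$ such that $F(C_\alpha)=C'_{f(\alpha)}$ for all $\alpha\in A$. **Models and Morita equivalence.** For a complete category $D$, a model of $(E,A,\{C_\alpha\})$ in $D$ is a functor $E\to D$ sending each $C_\alpha$ to a limit cone in $D$; $\mathrm{Mod}(E;D)$ is the full subcategory of the functor category $[E,D]$ on the models. A morphism of limit sketches $(F,f):(E,A,\{C_\alpha\})\to(E',B,\{C'_\beta\})$ is a Morita equivalence if for every complete category $D$ the functor $(F,f)^*:\mathrm{Mod}(E';D)\to\mathrm{Mod}(E;D)$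 induced by precomposition with $F$ is an equivalence of categories. **Orthogonality.** For morphisms $f:x\to y$, $g:a\to b$ of a category, $f\downarrow g$ means that every commutative square with left side $f$ and right side $g$ has a unique diagonal filler $y\to a$. For a class $H$ of morphisms, $H^{\downarrow}=\{f\mid h\downarrow f\ \forall h\in H\}$ and $H^{\uparrow}=\{f\mid f\downarrow h\ \forall h\in H\}$. **The object $\mathrm{Fib}_E(!)$.** $\mathbf{Cat}$ is the category of small categories, and $E/\mathbf{Cat}$ is the coslice category. For $y$ an object of $E$ and $\alpha\in A$, let $i_{y,\alpha}:E\to E[y;\alpha]$ with $\gamma:i_{y,\alpha}\circ *_y\Rightarrow i_{y,\alpha}\circ\phi_\alpha$ (where $*_y:I_\alpha\to E$) be the initial triple $(D,F,\psi)$ consisting of a small category $D$, a functor $F:E\to D$ and a natural transformation $\psi:F\circ *_y\Rightarrow F\circ\phi_\alpha$ (morphisms $(D,F,\psi)\to(D',F',\psi')$ being functors $H:D\to D'$ with $HF=F'$, $H\psi=\psi'$). Let $r_{y,\alpha}:E[y;\alpha]\to E[y;\alpha]'$ be obtained by freely adjoining a morphism $f_{y,\alpha}:y\to x_\alpha$ subject to $(\delta_\alpha)_i\circ f_{y,\alpha}=\gamma_i$ for every object $i$ of $I_\alpha$. Let $\Xi_E$ be the set of all $r_{y,\alpha}$, regarded as morphisms $(E[y;\alpha],i_{y,\alpha})\to(E[y;\alpha]',r_{y,\alpha}\circ i_{y,\alpha})$ of $E/\mathbf{Cat}$, and put $\mathcal R_E=\Xi_E^{\downarrow}$, $\mathcal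 L_E=\Xi_E^{\downarrow\uparrow}$; this is an orthogonal factorization system on $E/\mathbf{Cat}$, with a chosen functorial factorization. Applied to the unique morphism $!$ in $E/\mathbf{Cat}$ from the initial object $(E,\mathrm{id}_E)$ to the terminal object (the terminal category $*$), it gives $E\xrightarrow{L_E(!)}\mathrm{Fib}_E(!)\to *$ with first map in $\mathcal L_E$ and second in $\mathcal R_E$. The universal realization is $\mathrm{Fr}(E)=(\mathrm{Fib}_E(!),A,\{L_E(!)(C_\alpha)\}_{\alpha\in A})$. *)

theory Defs
  imports Main "HOL-Library.FuncSet"
begin

unbundle cardinal_syntax

section \<open>Smallness\<close>

text \<open>
  Smallness is relative to a type 'u whose cardinality is that of a Grothendieck universe, i.e.
  an uncountable strongly inaccessible cardinal. A small set is one of cardinality strictly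
  below that of 'u; up to bijection, every small set is a small subset of 'u.
\<close>

definition universe :: "'u itself \<Rightarrow> bool" where
  "universe _ \<longleftrightarrow>
     natLeq <o |UNIV :: 'u set| \<and>
     regularCard |UNIV :: 'u set| \<and>
     (\<forall>X :: 'u set. |X| <o |UNIV :: 'u set| \<longrightarrow> |Pow X| <o |UNIV :: 'u set| )"

definition small :: "'u itself \<Rightarrow> 'x set \<Rightarrow> bool" where
  "small _ X \<longleftrightarrow> |X| <o |UNIV :: 'u set|"


section \<open>Categories, functors, natural transformations\<close>

text \<open>\<open>Comp C g f\<close> is the composite of \<open>f\<close> followed by \<open>g\<close>. Hom-sets are not required to be small.\<close>

record ('o, 'a) cat =
  Ob :: "'o set"
  Ar :: "'a set"
  Dom :: "'a \<Rightarrow> 'o"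
  Cod :: "'a \<Rightarrow> 'o"
  Id :: "'o \<Rightarrow> 'a"
  Comp :: "'a \<Rightarrow> 'a \<Rightarrow> 'a"

definition hom :: "('o, 'a) cat \<Rightarrow> 'o \<Rightarrow> 'o \<Rightarrow> 'a set" where
  "hom C x y = {f \<in> Ar C. Dom C f = x \<and> Cod C f = y}"

definition category :: "('o, 'a) cat \<Rightarrow> bool" where
  "category C \<longleftrightarrow>
     (\<forall>f\<in>Ar C. Dom C f \<in> Ob C \<and> Cod C f \<in> Ob C) \<and>
     (\<forall>x\<in>Ob C. Id C x \<in> hom C x x) \<and>
     (\<forall>f\<in>Ar C. \<forall>g\<in>Ar C. Cod C f = Dom C g \<longrightarrow> Comp C g f \<in> hom C (Dom C f) (Cod C g)) \<and>
     (\<forall>f\<in>Ar C. Comp C f (Id C (Dom C f)) = f \<and> Comp C (Id C (Cod C f)) f = f) \<and>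
     (\<forall>f\<in>Ar C. \<forall>g\<in>Ar C. \<forall>h\<in>Ar C. Cod C f = Dom C g \<longrightarrow> Cod C g = Dom C h \<longrightarrow>
        Comp C h (Comp C g f) = Comp C (Comp C h g) f)"

definition small_cat :: "('u, 'u) cat \<Rightarrow> bool" where
  "small_cat C \<longleftrightarrow> category C \<and> small TYPE('u) (Ob C) \<and> small TYPE('u) (Ar C)"

definition is_iso :: "('o, 'a) cat \<Rightarrow> 'a \<Rightarrow> bool" where
  "is_iso C f \<longleftrightarrow> f \<in> Ar C \<and>
     (\<exists>g \<in> hom C (Cod C f) (Dom C f).
        Comp C g f = Id C (Dom C f) \<and> Comp C f g = Id C (Cod C f))"

text \<open>
  Functors and natural transformations are extensional, i.e. \<open>undefined\<close> off the objects and
  arrows of their source, so that HOL equality is equality of functors (of transformations).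
  This is why composition, whiskering etc. take the source category as an argument.
\<close>

record ('o, 'a, 'p, 'b) func =
  omap :: "'o \<Rightarrow> 'p"
  amap :: "'a \<Rightarrow> 'b"

definition is_functor ::
  "('o, 'a) cat \<Rightarrow> ('p, 'b) cat \<Rightarrow> ('o, 'a, 'p, 'b) func \<Rightarrow> bool" where
  "is_functor C D F \<longleftrightarrow>
     omap F \<in> Ob C \<rightarrow>\<^sub>E Ob D \<and>
     amap F \<in> Ar C \<rightarrow>\<^sub>E Ar D \<and>
     (\<forall>f\<in>Ar C. Dom D (amap F f) = omap F (Dom C f) \<and> Cod D (amap F f) = omap F (Cod C f)) \<and>
     (\<forall>x\<in>Ob C. amap F (Id C x) = Id D (omap F x)) \<and>
     (\<forall>f\<in>Ar C. \<forall>g\<in>Ar C. Cod C f = Dom C g \<longrightarrow>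
        amap F (Comp C g f) = Comp D (amap F g) (amap F f))"

definition id_func :: "('o, 'a) cat \<Rightarrow> ('o, 'a, 'o, 'a) func" where
  "id_func C = \<lparr>omap = (\<lambda>x\<in>Ob C. x), amap = (\<lambda>f\<in>Ar C. f)\<rparr>"

definition comp_func ::
  "('o, 'a) cat \<Rightarrow> ('p, 'b, 'q, 'c) func \<Rightarrow> ('o, 'a, 'p, 'b) func \<Rightarrow> ('o, 'a, 'q, 'c) func" where
  "comp_func C G F =
     \<lparr>omap = (\<lambda>x\<in>Ob C. omap G (omap F x)), amap = (\<lambda>f\<in>Ar C. amap G (amap F f))\<rparr>"

definition const_func :: "('i, 'j) cat \<Rightarrow> ('o, 'a) cat \<Rightarrow> 'o \<Rightarrow> ('i, 'j, 'o, 'a) func" where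
  "const_func I C x = \<lparr>omap = (\<lambda>i\<in>Ob I. x), amap = (\<lambda>f\<in>Ar I. Id C x)\<rparr>"

definition nat_trans ::
  "('o, 'a) cat \<Rightarrow> ('p, 'b) cat \<Rightarrow> ('o, 'a, 'p, 'b) func \<Rightarrow> ('o, 'a, 'p, 'b) func \<Rightarrow>
   ('o \<Rightarrow> 'b) \<Rightarrow> bool" where
  "nat_trans C D F G \<eta> \<longleftrightarrow>
     \<eta> \<in> extensional (Ob C) \<and>
     (\<forall>x\<in>Ob C. \<eta> x \<in> hom D (omap F x) (omap G x)) \<and>
     (\<forall>f\<in>Ar C. Comp D (amap G f) (\<eta> (Dom C f)) = Comp D (\<eta> (Cod C f)) (amap F f))"

definition nat_iso ::
  "('o, 'a) cat \<Rightarrow> ('p, 'b) cat \<Rightarrow> ('o, 'a, 'p, 'b) func \<Rightarrow> ('o, 'a, 'p, 'b) func \<Rightarrow>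
   ('o \<Rightarrow> 'b) \<Rightarrow> bool" where
  "nat_iso C D F G \<eta> \<longleftrightarrow> nat_trans C D F G \<eta> \<and> (\<forall>x\<in>Ob C. is_iso D (\<eta> x))"

text \<open>\<open>whisker C H \<eta>\<close> is \<open>H \<eta>\<close> for \<open>\<eta>\<close> a transformation between functors out of \<open>C\<close>.\<close>

definition whisker ::
  "('o, 'a) cat \<Rightarrow> ('p, 'b, 'q, 'c) func \<Rightarrow> ('o \<Rightarrow> 'b) \<Rightarrow> ('o \<Rightarrow> 'c)" where
  "whisker C H \<eta> = (\<lambda>x\<in>Ob C. amap H (\<eta> x))"

definition is_equivalence ::
  "('o, 'a) cat \<Rightarrow> ('p, 'b) cat \<Rightarrow> ('o, 'a, 'p, 'b) func \<Rightarrow> bool" where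
  "is_equivalence C D \<Phi> \<longleftrightarrow> is_functor C D \<Phi> \<and>
     (\<exists>\<Psi>. is_functor D C \<Psi> \<and>
        (\<exists>\<eta>. nat_iso C C (id_func C) (comp_func C \<Psi> \<Phi>) \<eta>) \<and>
        (\<exists>\<epsilon>. nat_iso D D (comp_func D \<Phi> \<Psi>) (id_func D) \<epsilon>))"

definition full_subcat :: "('o, 'a) cat \<Rightarrow> 'o set \<Rightarrow> ('o, 'a) cat" where
  "full_subcat C X =
     C\<lparr>Ob := Ob C \<inter> X, Ar := {f \<in> Ar C. Dom C f \<in> X \<and> Cod C f \<in> X}\<rparr>"

definition functor_cat ::
  "('o, 'a) cat \<Rightarrow> ('p, 'b) cat \<Rightarrow>
   (('o, 'a, 'p, 'b) func,
    ('o, 'a, 'p, 'b) func \<times> ('o, 'a, 'p, 'b) func \<times> ('o \<Rightarrow> 'b)) cat" where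
  "functor_cat C D =
     \<lparr>Ob = {F. is_functor C D F},
      Ar = {(F, G, \<eta>). is_functor C D F \<and> is_functor C D G \<and> nat_trans C D F G \<eta>},
      Dom = (\<lambda>(F, G, \<eta>). F),
      Cod = (\<lambda>(F, G, \<eta>). G),
      Id = (\<lambda>F. (F, F, \<lambda>x\<in>Ob C. Id D (omap F x))),
      Comp = (\<lambda>(G', H, \<theta>) (F, G, \<eta>). (F, H, \<lambda>x\<in>Ob C. Comp D (\<theta> x) (\<eta> x)))\<rparr>"


section \<open>Cones and limits\<close>

record ('u, 'o, 'a) cone =
  vertex :: 'o
  index :: "('u, 'u) cat"
  diagram :: "('u, 'u, 'o, 'a) func"
  legs :: "'u \<Rightarrow> 'a"

definition is_cone :: "('o, 'a) cat \<Rightarrow> ('u, 'o, 'a) cone \<Rightarrow> bool" where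
  "is_cone E C \<longleftrightarrow>
     vertex C \<in> Ob E \<and>
     small_cat (index C) \<and>
     is_functor (index C) E (diagram C) \<and>
     nat_trans (index C) E (const_func (index C) E (vertex C)) (diagram C) (legs C)"

definition map_cone ::
  "('o, 'a, 'p, 'b) func \<Rightarrow> ('u, 'o, 'a) cone \<Rightarrow> ('u, 'p, 'b) cone" where
  "map_cone F C =
     \<lparr>vertex = omap F (vertex C),
      index = index C,
      diagram = comp_func (index C) F (diagram C),
      legs = whisker (index C) F (legs C)\<rparr>"

definition limit_cone :: "('o, 'a) cat \<Rightarrow> ('u, 'o, 'a) cone \<Rightarrow> bool" where
  "limit_cone D C \<longleftrightarrow> is_cone D C \<and>
     (\<forall>d\<in>Ob D. \<forall>\<psi>. nat_trans (index C) D (const_func (index C) D d) (diagram C) \<psi> \<longrightarrow>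
        (\<exists>!u. u \<in> hom D d (vertex C) \<and> (\<forall>i\<in>Ob (index C). Comp D (legs C i) u = \<psi> i)))"

definition complete_cat :: "'u itself \<Rightarrow> ('o, 'a) cat \<Rightarrow> bool" where
  "complete_cat _ D \<longleftrightarrow> category D \<and>
     (\<forall>(I :: ('u, 'u) cat) \<phi>. small_cat I \<and> is_functor I D \<phi> \<longrightarrow>
        (\<exists>C. limit_cone D C \<and> index C = I \<and> diagram C = \<phi>))"


section \<open>Limit sketches, models, Morita equivalence\<close>

record ('u, 'k) sketch =
  base :: "('u, 'u) cat"
  labels :: "'k set"
  cones :: "'k \<Rightarrow> ('u, 'u, 'u) cone"

definition limit_sketch :: "('u, 'k) sketch \<Rightarrow> bool" where
  "limit_sketch S \<longleftrightarrow> small_cat (base S) \<and> small TYPE('u) (labels S) \<and>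
     (\<forall>\<alpha>\<in>labels S. is_cone (base S) (cones S \<alpha>))"

definition sketch_morphism ::
  "('u, 'k) sketch \<Rightarrow> ('u, 'l) sketch \<Rightarrow> ('u, 'u, 'u, 'u) func \<Rightarrow> ('k \<Rightarrow> 'l) \<Rightarrow> bool" where
  "sketch_morphism S S' F f \<longleftrightarrow>
     limit_sketch S \<and> limit_sketch S' \<and>
     is_functor (base S) (base S') F \<and>
     f \<in> labels S \<rightarrow> labels S' \<and>
     (\<forall>\<alpha>\<in>labels S. map_cone F (cones S \<alpha>) = cones S' (f \<alpha>))"

definition Mod ::
  "('u, 'k) sketch \<Rightarrow> ('o, 'a) cat \<Rightarrow>
   (('u, 'u, 'o, 'a) func,
    ('u, 'u, 'o, 'a) func \<times> ('u, 'u, 'o, 'a) func \<times> ('u \<Rightarrow> 'a)) cat" where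
  "Mod S D = full_subcat (functor_cat (base S) D)
     {M. \<forall>\<alpha>\<in>labels S. limit_cone D (map_cone M (cones S \<alpha>))}"

definition precomp ::
  "('u, 'k) sketch \<Rightarrow> ('u, 'l) sketch \<Rightarrow> ('u, 'u, 'u, 'u) func \<Rightarrow> ('o, 'a) cat \<Rightarrow>
   (('u, 'u, 'o, 'a) func,
    ('u, 'u, 'o, 'a) func \<times> ('u, 'u, 'o, 'a) func \<times> ('u \<Rightarrow> 'a),
    ('u, 'u, 'o, 'a) func,
    ('u, 'u, 'o, 'a) func \<times> ('u, 'u, 'o, 'a) func \<times> ('u \<Rightarrow> 'a)) func" where
  "precomp S S' F D =
     \<lparr>omap = (\<lambda>N\<in>Ob (Mod S' D). comp_func (base S) N F),
      amap = (\<lambda>(N, N', \<eta>)\<in>Ar (Mod S' D).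
                (comp_func (base S) N F, comp_func (base S) N' F,
                 \<lambda>x\<in>Ob (base S). \<eta> (omap F x)))\<rparr>"

text \<open>
  HOL cannot quantify over types inside a formula: \<open>D\<close> ranges over the complete categories with
  objects in \<open>'o\<close> and arrows in \<open>'a\<close>, and a theorem concluding \<open>morita_equivalence\<close> has to be
  stated for arbitrary types \<open>'o\<close> and \<open>'a\<close>.
\<close>

definition morita_equivalence ::
  "'o itself \<Rightarrow> 'a itself \<Rightarrow> ('u, 'k) sketch \<Rightarrow> ('u, 'l) sketch \<Rightarrow>
   ('u, 'u, 'u, 'u) func \<Rightarrow> ('k \<Rightarrow> 'l) \<Rightarrow> bool" where
  "morita_equivalence _ _ S S' F f \<longleftrightarrow>
     sketch_morphism S S' F f \<and>
     (\<forall>D :: ('o, 'a) cat. complete_cat TYPE('u) D \<longrightarrow>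
        is_equivalence (Mod S' D) (Mod S D) (precomp S S' F D))"


section \<open>Orthogonality\<close>

definition orthogonal :: "('o, 'a) cat \<Rightarrow> 'a \<Rightarrow> 'a \<Rightarrow> bool" where
  "orthogonal C f g \<longleftrightarrow>
     (\<forall>u \<in> hom C (Dom C f) (Dom C g). \<forall>v \<in> hom C (Cod C f) (Cod C g).
        Comp C g u = Comp C v f \<longrightarrow>
        (\<exists>!d. d \<in> hom C (Cod C f) (Dom C g) \<and> Comp C d f = u \<and> Comp C g d = v))"

definition right_orth :: "('o, 'a) cat \<Rightarrow> 'a set \<Rightarrow> 'a set" where
  "right_orth C H = {f \<in> Ar C. \<forall>h\<in>H. orthogonal C h f}"

definition left_orth :: "('o, 'a) cat \<Rightarrow> 'a set \<Rightarrow> 'a set" where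
  "left_orth C H = {f \<in> Ar C. \<forall>h\<in>H. orthogonal C f h}"


section \<open>The category of small categories and its coslices\<close>

type_synonym 'u cat_arrow = "('u, 'u) cat \<times> ('u, 'u) cat \<times> ('u, 'u, 'u, 'u) func"

definition Cat :: "(('u, 'u) cat, 'u cat_arrow) cat" where
  "Cat =
     \<lparr>Ob = {C. small_cat C},
      Ar = {(C, D, F). small_cat C \<and> small_cat D \<and> is_functor C D F},
      Dom = (\<lambda>(C, D, F). C),
      Cod = (\<lambda>(C, D, F). D),
      Id = (\<lambda>C. (C, C, id_func C)),
      Comp = (\<lambda>(D', B, G) (C, D, F). (C, B, comp_func C G F))\<rparr>"

text \<open>
  An object of the coslice under \<open>e\<close> is an arrow \<open>p\<close> out of \<open>e\<close>; the arrow \<open>(p, h, q)\<close> is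
  \<open>h\<close> regarded as a morphism from \<open>p\<close> to \<open>q\<close>.
\<close>

definition coslice :: "('o, 'a) cat \<Rightarrow> 'o \<Rightarrow> ('a, 'a \<times> 'a \<times> 'a) cat" where
  "coslice K e =
     \<lparr>Ob = {p \<in> Ar K. Dom K p = e},
      Ar = {(p, h, q). p \<in> Ar K \<and> Dom K p = e \<and> q \<in> Ar K \<and> Dom K q = e \<and>
                       h \<in> hom K (Cod K p) (Cod K q) \<and> Comp K h p = q},
      Dom = (\<lambda>(p, h, q). p),
      Cod = (\<lambda>(p, h, q). q),
      Id = (\<lambda>p. (p, Id K (Cod K p), p)),
      Comp = (\<lambda>(q', k, r) (p, h, q). (p, Comp K k h, r))\<rparr>"

definition one_cat :: "('u, 'u) cat" where
  "one_cat =
     \<lparr>Ob = {undefined}, Ar = {undefined}, Dom = (\<lambda>_. undefined), Cod = (\<lambda>_. undefined),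
      Id = (\<lambda>_. undefined), Comp = (\<lambda>_ _. undefined)\<rparr>"


section \<open>The factorization system of a limit sketch\<close>

text \<open>
  Below, \<open>C\<close> is a cone \<open>C\<^sub>\<alpha>\<close> of a sketch on \<open>E\<close> and \<open>y\<close> an object of \<open>E\<close>.
  The free constructions \<open>E[y;\<alpha>]\<close> and \<open>E[y;\<alpha>]'\<close> are given by their universal properties.
\<close>

definition cone_triple ::
  "('u, 'u) cat \<Rightarrow> ('u, 'u, 'u) cone \<Rightarrow> 'u \<Rightarrow>
   ('u, 'u) cat \<Rightarrow> ('u, 'u, 'u, 'u) func \<Rightarrow> ('u \<Rightarrow> 'u) \<Rightarrow> bool" where
  "cone_triple E C y D F \<psi> \<longleftrightarrow>
     small_cat D \<and> is_functor E D F \<and>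
     nat_trans (index C) D (comp_func (index C) F (const_func (index C) E y))
                           (comp_func (index C) F (diagram C)) \<psi>"

definition initial_cone_triple ::
  "('u, 'u) cat \<Rightarrow> ('u, 'u, 'u) cone \<Rightarrow> 'u \<Rightarrow>
   ('u, 'u) cat \<Rightarrow> ('u, 'u, 'u, 'u) func \<Rightarrow> ('u \<Rightarrow> 'u) \<Rightarrow> bool" where
  "initial_cone_triple E C y D F \<psi> \<longleftrightarrow>
     cone_triple E C y D F \<psi> \<and>
     (\<forall>D' F' \<psi>'. cone_triple E C y D' F' \<psi>' \<longrightarrow>
        (\<exists>!H. is_functor D D' H \<and> comp_func E H F = F' \<and> whisker (index C) H \<psi> = \<psi>'))"

definition cone_lift ::
  "('u, 'u, 'u) cone \<Rightarrow> 'u \<Rightarrow>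
   ('u, 'u) cat \<Rightarrow> ('u, 'u, 'u, 'u) func \<Rightarrow> ('u \<Rightarrow> 'u) \<Rightarrow>
   ('u, 'u) cat \<Rightarrow> ('u, 'u, 'u, 'u) func \<Rightarrow> 'u \<Rightarrow> bool" where
  "cone_lift C y D F \<gamma> D' r f \<longleftrightarrow>
     small_cat D' \<and> is_functor D D' r \<and>
     f \<in> hom D' (omap r (omap F y)) (omap r (omap F (vertex C))) \<and>
     (\<forall>i\<in>Ob (index C). Comp D' (amap r (amap F (legs C i))) f = amap r (\<gamma> i))"

definition free_cone_lift ::
  "('u, 'u, 'u) cone \<Rightarrow> 'u \<Rightarrow>
   ('u, 'u) cat \<Rightarrow> ('u, 'u, 'u, 'u) func \<Rightarrow> ('u \<Rightarrow> 'u) \<Rightarrow>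
   ('u, 'u) cat \<Rightarrow> ('u, 'u, 'u, 'u) func \<Rightarrow> 'u \<Rightarrow> bool" where
  "free_cone_lift C y D F \<gamma> D' r f \<longleftrightarrow>
     cone_lift C y D F \<gamma> D' r f \<and>
     (\<forall>D'' r' f'. cone_lift C y D F \<gamma> D'' r' f' \<longrightarrow>
        (\<exists>!H. is_functor D' D'' H \<and> comp_func D H r = r' \<and> amap H f = f'))"

text \<open>
  As \<open>E[y;\<alpha>]\<close> and \<open>E[y;\<alpha>]'\<close> are only determined up to unique isomorphism, \<open>Xi S\<close> contains all
  representatives of each \<open>r\<^sub>y\<^sub>,\<^sub>\<alpha>\<close>. Its right orthogonal is that of any choice of representatives.
\<close>

definition Xi :: "('u, 'k) sketch \<Rightarrow> ('u cat_arrow \<times> 'u cat_arrow \<times> 'u cat_arrow) set" where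
  "Xi S =
     {((base S, D, i), (D, D', r), (base S, D', comp_func (base S) r i)) | y \<alpha> D i \<gamma> D' r f.
        y \<in> Ob (base S) \<and> \<alpha> \<in> labels S \<and>
        initial_cone_triple (base S) (cones S \<alpha>) y D i \<gamma> \<and>
        free_cone_lift (cones S \<alpha>) y D i \<gamma> D' r f}"

definition R_class :: "('u, 'k) sketch \<Rightarrow> ('u cat_arrow \<times> 'u cat_arrow \<times> 'u cat_arrow) set" where
  "R_class S = right_orth (coslice Cat (base S)) (Xi S)"

definition L_class :: "('u, 'k) sketch \<Rightarrow> ('u cat_arrow \<times> 'u cat_arrow \<times> 'u cat_arrow) set" where
  "L_class S = left_orth (coslice Cat (base S)) (R_class S)"

definition bang :: "('u, 'u) cat \<Rightarrow> 'u cat_arrow \<times> 'u cat_arrow \<times> 'u cat_arrow" where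
  "bang E = (let t = (E, one_cat, const_func E one_cat undefined)
             in ((E, E, id_func E), t, t))"

text \<open>
  \<open>Fib\<close> and \<open>L : E \<rightarrow> Fib\<close> come from a factorization of the arrow \<open>bang E\<close> from the initial to the
  terminal object of the coslice into an arrow of the left class followed by one of the right
  class. Such a factorization is determined up to unique isomorphism.
\<close>

definition bang_factorization ::
  "('u, 'k) sketch \<Rightarrow> ('u, 'u) cat \<Rightarrow> ('u, 'u, 'u, 'u) func \<Rightarrow> bool" where
  "bang_factorization S Fib L \<longleftrightarrow>
     (\<exists>l \<in> L_class S. \<exists>r \<in> R_class S.
        Cod (coslice Cat (base S)) l = (base S, Fib, L) \<and>
        Dom (coslice Cat (base S)) r = (base S, Fib, L) \<and>
        Comp (coslice Cat (base S)) r l = bang (base S))"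

definition Fr ::
  "('u, 'k) sketch \<Rightarrow> ('u, 'u) cat \<Rightarrow> ('u, 'u, 'u, 'u) func \<Rightarrow> ('u, 'k) sketch" where
  "Fr S Fib L =
     \<lparr>base = Fib, labels = labels S, cones = (\<lambda>\<alpha>. map_cone L (cones S \<alpha>))\<rparr>"

end

theory Submission
  imports Defs
begin

text \<open>
  Precomposition with \<open>L\<close> is an isomorphism of categories. The key point is that every functor
  \<open>M : E \<rightarrow> D\<close> for which cones with vertex in the image of \<open>M\<close> lift uniquely through the
  \<open>M C\<^sub>\<alpha>\<close> extends uniquely along \<open>L\<close>. For small \<open>D\<close> this is orthogonality of \<open>L\<close> to
  \<open>D \<rightarrow> *\<close>, which lies in the right class by the universal properties of \<open>E[y;\<alpha>]\<close> and
  \<open>E[y;\<alpha>]'\<close>. In general, \<open>M\<close> factors through a subcategory of \<open>D\<close> that is closed under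
  these lifts and still small; here inaccessibility is used, since not even the hom-sets of \<open>D\<close>
  are small. A natural transformation of models is a functor into the arrow category of \<open>D\<close>,
  so the same extension result handles morphisms.
\<close>

section \<open>Small sets\<close>

text \<open>\<open>R_class\<close> lives in the coslice of small categories carried by
  \<open>'u\<close>. A complete \<open>D\<close> is in general no object there, and a small
  subcategory through which \<open>M\<close> factors is in general not complete. So the condition
  carried through the proof is weaker than being a model: \<open>lifting_functor\<close> tests the
  universal property of the cones \<open>M C\<^sub>\<alpha>\<close> only at vertices
  \<open>M y\<close>. This is what orthogonality to the arrows in \<open>Xi\<close> needs, and it
  survives shrinking \<open>D\<close> once the remaining arrows are closed under lifts.
  Orthogonality in \<open>Cat\<close> concerns equality of functors, so extensions are strictly
  unique; hence an isomorphism and not only an equivalence. No limit has to be recomputed on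
  \<open>Fib\<close>: the cones of \<open>Fr\<close> are the images under \<open>L\<close>, so
  \<open>N\<close> is a model exactly when \<open>N L\<close> is one. Transformations use the model
  condition at more vertices, since there arrows from the image of one model to the image of another
  have to be compared.\<close>

lemma small_subset:
  fixes A B :: "'x set"
  shows "small TYPE('u) B \<Longrightarrow> A \<subseteq> B \<Longrightarrow> small TYPE('u) A"
  unfolding small_def using card_of_mono1 ordLeq_ordLess_trans by blast

lemma small_image:
  "small TYPE('u) A \<Longrightarrow> small TYPE('u) (f ` A)"
  unfolding small_def using card_of_image ordLeq_ordLess_trans by blast

lemma small_inj_into:
  fixes A :: "'x set"
  assumes "small TYPE('u) A"
  obtains e :: "'x \<Rightarrow> 'u" where "inj_on e A"
  using assms unfolding small_def
  by (meson card_of_ordLeq ordLess_imp_ordLeq)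

lemma small_inj_image:
  assumes "inj_on f A" "small TYPE('u) (f ` A)"
  shows "small TYPE('u) A"
  using small_image[OF assms(2), of "inv_into A f"] assms(1) by simp

context
  assumes universe: "universe TYPE('u)"
begin

lemma universe_infinite: "infinite (UNIV :: 'u set)"
proof -
  have "natLeq <o |UNIV :: 'u set|" using universe unfolding universe_def by auto
  then show ?thesis
    using infinite_iff_natLeq_ordLeq ordLess_imp_ordLeq by blast
qed

lemma small_nat: "small TYPE('u) (A :: nat set)"
proof -
  have "natLeq <o |UNIV :: 'u set|" using universe unfolding universe_def by auto
  then have "small TYPE('u) (UNIV :: nat set)"
    unfolding small_def using card_of_nat ordIso_ordLess_trans by blast
  then show ?thesis by (rule small_subset) simp
qed

lemma small_finite: "finite A \<Longrightarrow> small TYPE('u) A"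
  unfolding small_def using universe_infinite
  by (intro finite_ordLess_infinite) (auto simp: Field_card_of card_of_well_order_on)

text \<open>For an infinite cardinal, regularity is stability, that is, closure under unions of
  fewer than that many smaller sets.\<close>

lemma small_UN:
  assumes "small TYPE('u) I" "\<And>i. i \<in> I \<Longrightarrow> small TYPE('u) (A i)"
  shows "small TYPE('u) (\<Union>i\<in>I. A i)"
proof -
  have "regularCard |UNIV :: 'u set|" using universe unfolding universe_def by auto
  then have "stable |UNIV :: 'u set|"
    by (intro regularCard_stable card_of_Card_order) (auto simp: Field_card_of universe_infinite)
  then show ?thesis
    using stable_UNION[of "|UNIV :: 'u set|" I A] assms unfolding small_def by blast
qed

lemma small_Un: "small TYPE('u) A \<Longrightarrow> small TYPE('u) B \<Longrightarrow> small TYPE('u) (A \<union> B)"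
  using small_UN[of "{A, B}" "\<lambda>X. X"] small_finite[of "{A, B}"] by auto

lemma small_Sigma:
  assumes "small TYPE('u) A" "\<And>x. x \<in> A \<Longrightarrow> small TYPE('u) (B x)"
  shows "small TYPE('u) (Sigma A B)"
proof -
  have "Sigma A B = (\<Union>x\<in>A. Pair x ` B x)" by auto
  moreover have "small TYPE('u) (\<Union>x\<in>A. Pair x ` B x)"
    by (intro small_UN small_image assms)
  ultimately show ?thesis by simp
qed

text \<open>The strong limit clause of \<open>universe\<close> concerns subsets of \<open>'u\<close>
  only, so \<open>A\<close> is first moved into \<open>'u\<close> by an injection.\<close>

lemma small_Pow:
  fixes A :: "'x set"
  assumes "small TYPE('u) A"
  shows "small TYPE('u) (Pow A)"
proof -
  obtain e :: "'x \<Rightarrow> 'u" where e: "inj_on e A" using assms by (rule small_inj_into)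
  have "small TYPE('u) (Pow (e ` A))"
    using small_image[OF assms, of e] universe unfolding small_def universe_def by blast
  then have "small TYPE('u) ((`) e ` Pow A)"
    by (rule small_subset) auto
  then show ?thesis using small_inj_image inj_on_image_Pow[OF e] by blast
qed

text \<open>Lists are sorted by length. Uncountability of the universe enters here through
  \<open>small_nat\<close>: the set of all lengths must itself be small.\<close>

lemma small_lists:
  assumes "small TYPE('u) B"
  shows "small TYPE('u) (lists B)"
proof -
  have "small TYPE('u) {xs \<in> lists B. length xs = n}" for n
  proof (induction n)
    case 0
    then show ?case using small_finite[of "{[]}"] by (rule_tac small_subset) auto
  next
    case (Suc n)
    have "{xs \<in> lists B. length xs = Suc n}
        \<subseteq> (\<lambda>(x, xs). x # xs) ` (B \<times> {xs \<in> lists B. length xs = n})"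
      by (auto simp: length_Suc_conv image_iff)
    then show ?case
      by (rule small_subset[rotated]) (intro small_image small_Sigma assms Suc)
  qed
  then have "small TYPE('u) (\<Union>n. {xs \<in> lists B. length xs = n})"
    by (intro small_UN small_nat)
  then show ?thesis by (rule small_subset) auto
qed

end

section \<open>Closure under a small set of infinitary partial operations\<close>

text \<open>A rule \<open>l\<close> has one premise \<open>f b\<close> for each
  \<open>b \<in> ar l\<close>. \<open>R\<close> is a relation because the intended operations are
  partial: arrows compose only when they match, and only cones have lifts. Arities may be infinite,
  since a lift takes all legs of a cone as premises.\<close>

inductive_set gen_closure ::
  "'l set \<Rightarrow> ('l \<Rightarrow> 'b set) \<Rightarrow> ('l \<Rightarrow> ('b \<Rightarrow> 'a) \<Rightarrow> 'a \<Rightarrow> bool) \<Rightarrow> 'a set"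
  for \<Lambda> ar R where
  rule: "l \<in> \<Lambda> \<Longrightarrow> (\<And>b. b \<in> ar l \<Longrightarrow> f b \<in> gen_closure \<Lambda> ar R) \<Longrightarrow> R l f a \<Longrightarrow>
    a \<in> gen_closure \<Lambda> ar R"

text \<open>A derivation tree is coded as the set of pairs of a path from the root and the rule applied
  at the end of that path, hence as a subset of \<open>lists B \<times> \<Lambda>\<close>.\<close>

inductive derivation ::
  "'l set \<Rightarrow> ('l \<Rightarrow> 'b set) \<Rightarrow> ('l \<Rightarrow> ('b \<Rightarrow> 'a) \<Rightarrow> 'a \<Rightarrow> bool) \<Rightarrow>
   ('b list \<times> 'l) set \<Rightarrow> 'a \<Rightarrow> bool"
  for \<Lambda> ar R where
  node: "l \<in> \<Lambda> \<Longrightarrow> (\<And>b. b \<in> ar l \<Longrightarrow> derivation \<Lambda> ar R (T b) (f b)) \<Longrightarrow> R l f a \<Longrightarrow>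
    derivation \<Lambda> ar R (insert ([], l) {(b # p, m) | b p m. b \<in> ar l \<and> (p, m) \<in> T b}) a"

text \<open>The code determines the tree: the root rule is the one paired with the empty path, and
  the subtree at \<open>b\<close> is recovered by keeping the paths that start with \<open>b\<close>
  and deleting this letter. Induction then gives equal premises on the arity, and
  \<open>functional\<close> gives equal conclusions.\<close>

lemma derivation_functional:
  assumes functional: "\<forall>l\<in>\<Lambda>. \<forall>f g a a'. R l f a \<longrightarrow> R l g a' \<longrightarrow>
    (\<forall>b\<in>ar l. f b = g b) \<longrightarrow> a = a'"
    and "derivation \<Lambda> ar R T a" "derivation \<Lambda> ar R T a'"
  shows "a = a'"
  using assms(2,3)
proof (induction arbitrary: a')
  case (node l T f a)
  from node.prems show ?case
  proof cases
    case (node l' T' f')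
    have l: "l' = l" using node(1) by auto
    have "T b = T' b" if "b \<in> ar l" for b
    proof -
      have "T b = {(p, m). (b # p, m) \<in> insert ([], l) {(b # p, m) | b p m. b \<in> ar l \<and> (p, m) \<in> T b}}"
        using that by auto
      also have "\<dots> = {(p, m). (b # p, m) \<in> insert ([], l') {(b # p, m) | b p m. b \<in> ar l' \<and> (p, m) \<in> T' b}}"
        using node(1) by simp
      also have "\<dots> = T' b" using that l by auto
      finally show ?thesis .
    qed
    then have "f b = f' b" if "b \<in> ar l" for b
      using node.IH[OF that] node(3) that l by metis
    then show ?thesis using functional \<open>l \<in> \<Lambda>\<close> \<open>R l f a\<close> node(4) l by blast
  qed
qed

text \<open>Trees may branch infinitely, but every path in them is a finite list, so their codes
  form a small set. An element may have many derivations; it suffices that decoding by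
  \<open>THE\<close> maps the codes onto the closure. The size of the ambient type \<open>'a\<close>
  does not enter.\<close>

lemma small_gen_closure:
  fixes \<Lambda> :: "'l set" and ar :: "'l \<Rightarrow> 'b set" and R :: "'l \<Rightarrow> ('b \<Rightarrow> 'a) \<Rightarrow> 'a \<Rightarrow> bool"
  assumes universe: "universe TYPE('u)"
    and rules: "small TYPE('u) \<Lambda>" and small_arity: "\<And>l. l \<in> \<Lambda> \<Longrightarrow> small TYPE('u) (ar l)"
    and functional: "\<forall>l\<in>\<Lambda>. \<forall>f g a a'. R l f a \<longrightarrow> R l g a' \<longrightarrow>
      (\<forall>b\<in>ar l. f b = g b) \<longrightarrow> a = a'"
  shows "small TYPE('u) (gen_closure \<Lambda> ar R)"
proof -
  let ?codes = "Pow (lists (\<Union>l\<in>\<Lambda>. ar l) \<times> \<Lambda>)"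
  have "\<exists>T\<in>?codes. derivation \<Lambda> ar R T a" if "a \<in> gen_closure \<Lambda> ar R" for a
    using that
  proof induction
    case (rule l f a)
    then obtain T where T: "\<And>b. b \<in> ar l \<Longrightarrow> T b \<in> ?codes \<and> derivation \<Lambda> ar R (T b) (f b)"
      by metis
    then have "insert ([], l) {(b # p, m) | b p m. b \<in> ar l \<and> (p, m) \<in> T b} \<in> ?codes"
      using rule(1) by fastforce
    moreover have "derivation \<Lambda> ar R (insert ([], l) {(b # p, m) | b p m. b \<in> ar l \<and> (p, m) \<in> T b}) a"
      using T by (intro derivation.node[where f = f] rule) auto
    ultimately show ?case by blast
  qed
  moreover have "(THE a. derivation \<Lambda> ar R T a) = a" if "derivation \<Lambda> ar R T a" for T a
    using that derivation_functional[OF functional] by (intro the_equality) blast+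
  ultimately have "gen_closure \<Lambda> ar R \<subseteq> (\<lambda>T. THE a. derivation \<Lambda> ar R T a) ` ?codes"
    by (metis (no_types, lifting) image_eqI subsetI)
  moreover have "small TYPE('u) ?codes"
    using universe rules small_arity by (intro small_Pow small_Sigma small_lists small_UN)
  ultimately show ?thesis using small_subset small_image by metis
qed

section \<open>Categories and functors\<close>

lemma homD:
  assumes "f \<in> hom C x y"
  shows "f \<in> Ar C" "Dom C f = x" "Cod C f = y"
  using assms by (auto simp: hom_def)

lemma Ar_hom: "f \<in> Ar C \<Longrightarrow> f \<in> hom C (Dom C f) (Cod C f)"
  by (simp add: hom_def)

lemma hom_Ob:
  assumes "category C" "f \<in> hom C x y"
  shows "x \<in> Ob C" "y \<in> Ob C"
  using assms unfolding category_def hom_def by auto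

lemma Dom_Ob: "category C \<Longrightarrow> f \<in> Ar C \<Longrightarrow> Dom C f \<in> Ob C"
  and Cod_Ob: "category C \<Longrightarrow> f \<in> Ar C \<Longrightarrow> Cod C f \<in> Ob C"
  unfolding category_def by auto

lemma Id_hom: "category C \<Longrightarrow> x \<in> Ob C \<Longrightarrow> Id C x \<in> hom C x x"
  unfolding category_def by auto

lemma Comp_hom: "category C \<Longrightarrow> g \<in> hom C y z \<Longrightarrow> f \<in> hom C x y \<Longrightarrow> Comp C g f \<in> hom C x z"
  unfolding category_def by (auto simp: hom_def)

lemma Comp_Ar:
  assumes "category C" "f \<in> Ar C" "g \<in> Ar C" "Cod C f = Dom C g"
  shows "Comp C g f \<in> Ar C" "Dom C (Comp C g f) = Dom C f" "Cod C (Comp C g f) = Cod C g"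
  using assms unfolding category_def hom_def by auto

lemma Comp_Id_right: "category C \<Longrightarrow> f \<in> hom C x y \<Longrightarrow> Comp C f (Id C x) = f"
  and Comp_Id_left: "category C \<Longrightarrow> f \<in> hom C x y \<Longrightarrow> Comp C (Id C y) f = f"
  unfolding category_def hom_def by auto

lemma Comp_assoc:
  "category C \<Longrightarrow> h \<in> hom C z w \<Longrightarrow> g \<in> hom C y z \<Longrightarrow> f \<in> hom C x y \<Longrightarrow>
    Comp C (Comp C h g) f = Comp C h (Comp C g f)"
  unfolding category_def hom_def by auto

lemma categoryI:
  assumes "\<And>f. f \<in> Ar C \<Longrightarrow> Dom C f \<in> Ob C \<and> Cod C f \<in> Ob C"
    and "\<And>x. x \<in> Ob C \<Longrightarrow> Id C x \<in> hom C x x"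
    and "\<And>f g x y z. f \<in> hom C x y \<Longrightarrow> g \<in> hom C y z \<Longrightarrow> Comp C g f \<in> hom C x z"
    and "\<And>f x y. f \<in> hom C x y \<Longrightarrow> Comp C f (Id C x) = f"
    and "\<And>f x y. f \<in> hom C x y \<Longrightarrow> Comp C (Id C y) f = f"
    and "\<And>f g h x y z w. f \<in> hom C x y \<Longrightarrow> g \<in> hom C y z \<Longrightarrow> h \<in> hom C z w \<Longrightarrow>
      Comp C h (Comp C g f) = Comp C (Comp C h g) f"
  shows "category C"
  unfolding category_def using assms by (auto dest!: Ar_hom)

lemma small_catD: "small_cat C \<Longrightarrow> category C"
  by (simp add: small_cat_def)

lemma is_functorI:
  assumes "omap F \<in> extensional (Ob C)" "amap F \<in> extensional (Ar C)"
    and "\<And>x. x \<in> Ob C \<Longrightarrow> omap F x \<in> Ob D"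
    and "\<And>f. f \<in> Ar C \<Longrightarrow> amap F f \<in> hom D (omap F (Dom C f)) (omap F (Cod C f))"
    and "\<And>x. x \<in> Ob C \<Longrightarrow> amap F (Id C x) = Id D (omap F x)"
    and "\<And>f g. f \<in> Ar C \<Longrightarrow> g \<in> Ar C \<Longrightarrow> Cod C f = Dom C g \<Longrightarrow>
      amap F (Comp C g f) = Comp D (amap F g) (amap F f)"
  shows "is_functor C D F"
  using assms unfolding is_functor_def PiE_def hom_def by auto

lemma functor_ext:
  assumes "is_functor C D F"
  shows "omap F \<in> extensional (Ob C)" "amap F \<in> extensional (Ar C)"
  using assms unfolding is_functor_def PiE_def by auto

lemma functor_Ob: "is_functor C D F \<Longrightarrow> x \<in> Ob C \<Longrightarrow> omap F x \<in> Ob D"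
  unfolding is_functor_def by auto

lemma functor_hom: "is_functor C D F \<Longrightarrow> f \<in> hom C x y \<Longrightarrow> amap F f \<in> hom D (omap F x) (omap F y)"
  unfolding is_functor_def hom_def by auto

lemma functor_Ar:
  assumes "is_functor C D F" "f \<in> Ar C"
  shows "amap F f \<in> Ar D" "Dom D (amap F f) = omap F (Dom C f)" "Cod D (amap F f) = omap F (Cod C f)"
  using assms unfolding is_functor_def by auto

lemma functor_Id: "is_functor C D F \<Longrightarrow> x \<in> Ob C \<Longrightarrow> amap F (Id C x) = Id D (omap F x)"
  unfolding is_functor_def by auto

lemma functor_Comp:
  "is_functor C D F \<Longrightarrow> g \<in> hom C y z \<Longrightarrow> f \<in> hom C x y \<Longrightarrow>
    amap F (Comp C g f) = Comp D (amap F g) (amap F f)"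
  unfolding is_functor_def hom_def by auto

lemma functor_Comp_Ar:
  "is_functor C D F \<Longrightarrow> g \<in> Ar C \<Longrightarrow> f \<in> Ar C \<Longrightarrow> Cod C f = Dom C g \<Longrightarrow>
    amap F (Comp C g f) = Comp D (amap F g) (amap F f)"
  unfolding is_functor_def by auto

lemma functor_eqI:
  assumes "is_functor C D F" "is_functor C D' G"
    and "\<And>x. x \<in> Ob C \<Longrightarrow> omap F x = omap G x" "\<And>f. f \<in> Ar C \<Longrightarrow> amap F f = amap G f"
  shows "F = G"
  using assms by (intro func.equality) (auto intro: extensionalityI dest: functor_ext)

lemma comp_func_apply [simp]:
  "x \<in> Ob C \<Longrightarrow> omap (comp_func C G F) x = omap G (omap F x)"
  "f \<in> Ar C \<Longrightarrow> amap (comp_func C G F) f = amap G (amap F f)"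
  by (simp_all add: comp_func_def)

lemma id_func_apply [simp]:
  "x \<in> Ob C \<Longrightarrow> omap (id_func C) x = x"
  "f \<in> Ar C \<Longrightarrow> amap (id_func C) f = f"
  by (simp_all add: id_func_def)

lemma const_func_apply [simp]:
  "i \<in> Ob I \<Longrightarrow> omap (const_func I C x) i = x"
  "j \<in> Ar I \<Longrightarrow> amap (const_func I C x) j = Id C x"
  by (simp_all add: const_func_def)

lemma id_functor: "category C \<Longrightarrow> is_functor C C (id_func C)"
  by (rule is_functorI)
    (simp_all add: id_func_def Dom_Ob Cod_Ob Ar_hom homD(1)[OF Id_hom] Comp_Ar)

lemma comp_functor:
  assumes "category C" "is_functor C D F" "is_functor D K G"
  shows "is_functor C K (comp_func C G F)"
proof (rule is_functorI)
  fix f g assume "f \<in> Ar C" "g \<in> Ar C" "Cod C f = Dom C g"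
  then show "amap (comp_func C G F) (Comp C g f)
      = Comp K (amap (comp_func C G F) g) (amap (comp_func C G F) f)"
    using assms by (simp add: Comp_Ar functor_Comp_Ar functor_Ar)
next
  fix f assume "f \<in> Ar C"
  then show "amap (comp_func C G F) f
      \<in> hom K (omap (comp_func C G F) (Dom C f)) (omap (comp_func C G F) (Cod C f))"
    using assms by (simp add: Dom_Ob Cod_Ob functor_Ar hom_def)
qed (use assms in \<open>simp_all add: comp_func_def functor_Ob functor_Id homD(1)[OF Id_hom]\<close>)

lemma const_functor:
  assumes "category C" "category I" "x \<in> Ob C"
  shows "is_functor I C (const_func I C x)"
proof (rule is_functorI)
  fix f g assume "f \<in> Ar I" "g \<in> Ar I" "Cod I f = Dom I g"
  then show "amap (const_func I C x) (Comp I g f)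
      = Comp C (amap (const_func I C x) g) (amap (const_func I C x) f)"
    using assms Comp_Id_left[OF assms(1) Id_hom[OF assms(1,3)]] by (simp add: Comp_Ar)
qed (use assms in \<open>simp_all add: const_func_def Dom_Ob Cod_Ob Id_hom homD(1)[OF Id_hom]\<close>)

lemma comp_func_assoc:
  assumes "is_functor B C F"
  shows "comp_func B (comp_func C H G) F = comp_func B H (comp_func B G F)"
  unfolding comp_func_def using assms
  by (auto intro!: restrict_ext simp: functor_Ob functor_Ar)

lemma comp_id_func:
  assumes "is_functor C D F"
  shows "comp_func C F (id_func C) = F" "comp_func C (id_func D) F = F"
  using functor_ext[OF assms] assms unfolding comp_func_def
  by (auto intro!: func.equality extensionalityI[of _ "Ob C"] extensionalityI[of _ "Ar C"]
      simp: functor_Ob functor_Ar)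

lemma category_one_cat: "category one_cat"
  by (rule categoryI) (auto simp: one_cat_def hom_def)

lemma functor_one_cat_unique:
  assumes "is_functor C one_cat F" "is_functor C one_cat G"
  shows "F = G"
proof (rule functor_eqI[OF assms])
  show "omap F x = omap G x" if "x \<in> Ob C" for x
    using functor_Ob[OF assms(1) that] functor_Ob[OF assms(2) that] by (simp add: one_cat_def)
  show "amap F f = amap G f" if "f \<in> Ar C" for f
    using functor_Ar(1)[OF assms(1) that] functor_Ar(1)[OF assms(2) that] by (simp add: one_cat_def)
qed

section \<open>Subcategories sharing the structure of an ambient category\<close>

text \<open>The subcategory keeps \<open>Dom\<close>, \<open>Cod\<close>, \<open>Id\<close> and
  \<open>Comp\<close> of \<open>D\<close>, and functors are extensional on their source only. So a
  functor into the subcategory is literally a functor into \<open>D\<close>, and no inclusion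
  functor has to be carried along.\<close>

lemma functor_subcat_iff:
  fixes D :: "('o, 'a) cat"
  assumes "X \<subseteq> Ob D" "Y \<subseteq> Ar D"
  shows "is_functor C (D\<lparr>Ob := X, Ar := Y\<rparr>) F \<longleftrightarrow>
    is_functor C D F \<and> omap F ` Ob C \<subseteq> X \<and> amap F ` Ar C \<subseteq> Y"
  using assms unfolding is_functor_def PiE_def Pi_def by auto

lemma hom_subcat: "Y \<subseteq> Ar D \<Longrightarrow> hom (D\<lparr>Ob := X, Ar := Y\<rparr>) x y = hom D x y \<inter> Y"
  by (auto simp: hom_def)

lemma category_subcat:
  assumes "category D" "X \<subseteq> Ob D" "Y \<subseteq> Ar D"
    and "\<And>f. f \<in> Y \<Longrightarrow> Dom D f \<in> X \<and> Cod D f \<in> X"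
    and "\<And>x. x \<in> X \<Longrightarrow> Id D x \<in> Y"
    and "\<And>f g. f \<in> Y \<Longrightarrow> g \<in> Y \<Longrightarrow> Cod D f = Dom D g \<Longrightarrow> Comp D g f \<in> Y"
  shows "category (D\<lparr>Ob := X, Ar := Y\<rparr>)"
proof (rule categoryI)
  show "Id (D\<lparr>Ob := X, Ar := Y\<rparr>) x \<in> hom (D\<lparr>Ob := X, Ar := Y\<rparr>) x x"
    if "x \<in> Ob (D\<lparr>Ob := X, Ar := Y\<rparr>)" for x
    using that assms Id_hom[of D x] by (auto simp: hom_subcat[OF assms(3)])
qed (use assms in \<open>auto simp: hom_subcat[OF assms(3)] Comp_hom Comp_Id_left Comp_Id_right Comp_assoc homD\<close>)

section \<open>Unique lifts of cones\<close>

text \<open>A transformation from the constant functor at \<open>d\<close> to \<open>M\<close> after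
  the diagram, but without extensionality of \<psi>. Families such as the image of a cone under a
  functor can then be used without restricting them.\<close>

definition cone_over ::
  "('o, 'a) cat \<Rightarrow> ('p, 'b, 'o, 'a) func \<Rightarrow> ('u, 'p, 'b) cone \<Rightarrow> 'o \<Rightarrow> ('u \<Rightarrow> 'a) \<Rightarrow> bool" where
  "cone_over D M C d \<psi> \<longleftrightarrow>
     (\<forall>i\<in>Ob (index C). \<psi> i \<in> hom D d (omap M (omap (diagram C) i))) \<and>
     (\<forall>j\<in>Ar (index C). Comp D (amap M (amap (diagram C) j)) (\<psi> (Dom (index C) j))
       = \<psi> (Cod (index C) j))"

definition is_lift ::
  "('o, 'a) cat \<Rightarrow> ('p, 'b, 'o, 'a) func \<Rightarrow> ('u, 'p, 'b) cone \<Rightarrow> 'o \<Rightarrow> ('u \<Rightarrow> 'a) \<Rightarrow> 'a \<Rightarrow> bool" where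
  "is_lift D M C d \<psi> u \<longleftrightarrow>
     u \<in> hom D d (omap M (vertex C)) \<and> (\<forall>i\<in>Ob (index C). Comp D (amap M (legs C i)) u = \<psi> i)"

definition unique_lifts ::
  "('o, 'a) cat \<Rightarrow> ('p, 'b, 'o, 'a) func \<Rightarrow> ('u, 'p, 'b) cone \<Rightarrow> 'o \<Rightarrow> bool" where
  "unique_lifts D M C d \<longleftrightarrow> (\<forall>\<psi>. cone_over D M C d \<psi> \<longrightarrow> (\<exists>!u. is_lift D M C d \<psi> u))"

text \<open>Vertices are limited to \<open>M y\<close> because \<open>E[y;\<alpha>]\<close> adjoins
  cones with vertex an object \<open>y\<close> of \<open>E\<close>. In particular, closing a set of
  arrows under these lifts creates no new objects.\<close>

definition lifting_functor ::
  "('u, 'k) sketch \<Rightarrow> ('o, 'a) cat \<Rightarrow> ('u, 'u, 'o, 'a) func \<Rightarrow> bool" where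
  "lifting_functor S D M \<longleftrightarrow> is_functor (base S) D M \<and>
     (\<forall>y\<in>Ob (base S). \<forall>\<alpha>\<in>labels S. unique_lifts D M (cones S \<alpha>) (omap M y))"

lemma nat_trans_const_iff:
  assumes "category I" "category D"
  shows "nat_trans I D (const_func I D d) \<phi> \<psi> \<longleftrightarrow>
    \<psi> \<in> extensional (Ob I) \<and> (\<forall>i\<in>Ob I. \<psi> i \<in> hom D d (omap \<phi> i)) \<and>
    (\<forall>j\<in>Ar I. Comp D (amap \<phi> j) (\<psi> (Dom I j)) = \<psi> (Cod I j))"
proof -
  have "Comp D (\<psi> (Cod I j)) (Id D d) = \<psi> (Cod I j)"
    if "\<forall>i\<in>Ob I. \<psi> i \<in> hom D d (omap \<phi> i)" "j \<in> Ar I" for j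
    using that Comp_Id_right[OF assms(2)] Cod_Ob[OF assms(1)] by blast
  then show ?thesis unfolding nat_trans_def by (auto simp: Dom_Ob assms(1))
qed

lemma is_coneD:
  assumes "is_cone E C"
  shows "vertex C \<in> Ob E" "small_cat (index C)" "category (index C)"
    "is_functor (index C) E (diagram C)"
    "nat_trans (index C) E (const_func (index C) E (vertex C)) (diagram C) (legs C)"
  using assms unfolding is_cone_def small_cat_def by auto

lemma cone_legs:
  assumes "category E" "is_cone E C"
  shows "i \<in> Ob (index C) \<Longrightarrow> legs C i \<in> hom E (vertex C) (omap (diagram C) i)"
    "j \<in> Ar (index C) \<Longrightarrow>
      Comp E (amap (diagram C) j) (legs C (Dom (index C) j)) = legs C (Cod (index C) j)"
  using is_coneD(5)[OF assms(2)]
  by (simp_all add: nat_trans_const_iff[OF is_coneD(3)[OF assms(2)] assms(1)])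

lemma cone_diagram_hom:
  assumes "is_cone E C" "j \<in> Ar (index C)"
  shows "amap (diagram C) j
    \<in> hom E (omap (diagram C) (Dom (index C) j)) (omap (diagram C) (Cod (index C) j))"
  using functor_hom[OF is_coneD(4)[OF assms(1)] Ar_hom[OF assms(2)]] .

lemma cone_over_lift:
  assumes "category D" "category E" "is_functor E D M" "is_cone E C" "u \<in> hom D d (omap M (vertex C))"
  shows "cone_over D M C d (\<lambda>i. Comp D (amap M (legs C i)) u)"
proof -
  have I: "category (index C)" using is_coneD[OF assms(4)] by simp
  have "Comp D (amap M (amap (diagram C) j)) (Comp D (amap M (legs C (Dom (index C) j))) u)
      = Comp D (amap M (legs C (Cod (index C) j))) u" if j: "j \<in> Ar (index C)" for j
  proof -
    note legs = cone_legs(1)[OF assms(2,4) Dom_Ob[OF I j]]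
    show ?thesis
      using Comp_assoc[OF assms(1) functor_hom[OF assms(3) cone_diagram_hom[OF assms(4) j]]
          functor_hom[OF assms(3) legs] assms(5)]
        functor_Comp[OF assms(3) cone_diagram_hom[OF assms(4) j] legs] cone_legs(2)[OF assms(2,4) j]
      by simp
  qed
  then show ?thesis
    unfolding cone_over_def
    using Comp_hom[OF assms(1) functor_hom[OF assms(3) cone_legs(1)[OF assms(2,4)]] assms(5)] by auto
qed

lemma is_cone_map:
  assumes "category D" "category E" "is_functor E D M" "is_cone E C"
  shows "is_cone D (map_cone M C)"
proof -
  note C = is_coneD[OF assms(4)]
  have "nat_trans (index C) D (const_func (index C) D (omap M (vertex C)))
      (comp_func (index C) M (diagram C)) (whisker (index C) M (legs C))"
    unfolding nat_trans_const_iff[OF C(3) assms(1)]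
    using functor_hom[OF assms(3) cone_legs(1)[OF assms(2,4)]] cone_legs(2)[OF assms(2,4)]
      functor_Comp[OF assms(3) cone_diagram_hom[OF assms(4)] cone_legs(1)[OF assms(2,4)]]
      Dom_Ob[OF C(3)] Cod_Ob[OF C(3)]
    by (simp add: whisker_def)
  then show ?thesis
    unfolding is_cone_def map_cone_def
    using C comp_functor[OF C(3,4) assms(3)] functor_Ob[OF assms(3)] by simp
qed

text \<open>\<open>limit_cone\<close> ranges over extensional families, \<open>unique_lifts\<close>
  over arbitrary ones. This makes no difference: cones and lifts read \<psi> only on
  \<open>Ob (index C)\<close>, so \<psi> may be restricted to that set.\<close>

lemma limit_cone_map_iff:
  assumes "category D" "category E" "is_functor E D M" "is_cone E C"
  shows "limit_cone D (map_cone M C) \<longleftrightarrow> (\<forall>d\<in>Ob D. unique_lifts D M C d)"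
proof -
  let ?I = "index C"
  note I = is_coneD(3)[OF assms(4)]
  have nat: "nat_trans ?I D (const_func ?I D d) (comp_func ?I M (diagram C)) \<psi> \<longleftrightarrow>
      \<psi> \<in> extensional (Ob ?I) \<and> cone_over D M C d \<psi>" for d \<psi>
    by (simp add: nat_trans_const_iff[OF I assms(1)] cone_over_def cong: conj_cong)
  have restr: "cone_over D M C d (restrict \<psi> (Ob ?I)) \<longleftrightarrow> cone_over D M C d \<psi>" 
    "is_lift D M C d (restrict \<psi> (Ob ?I)) u \<longleftrightarrow> is_lift D M C d \<psi> u" for d \<psi> u
    by (simp_all add: cone_over_def is_lift_def Dom_Ob[OF I] Cod_Ob[OF I])
  have "unique_lifts D M C d \<longleftrightarrow> (\<forall>\<psi>. nat_trans ?I D (const_func ?I D d)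
      (comp_func ?I M (diagram C)) \<psi> \<longrightarrow> (\<exists>!u. is_lift D M C d \<psi> u))" for d
    unfolding unique_lifts_def nat using restr restrict_extensional by metis
  then show ?thesis
    using is_cone_map[OF assms] unfolding limit_cone_def
    by (simp add: map_cone_def is_lift_def whisker_def)
qed

section \<open>Extension along an arrow of the left class\<close>

lemma coslice_Cat_Ar:
  "a \<in> Ar (coslice Cat E) \<longleftrightarrow> (\<exists>A B F G H. a = ((E, A, F), (A, B, H), (E, B, G)) \<and>
    small_cat E \<and> small_cat A \<and> small_cat B \<and> is_functor E A F \<and> is_functor E B G \<and>
    is_functor A B H \<and> comp_func E H F = G)"
  by (auto simp: coslice_def Cat_def hom_def)

definition to_one :: "('u, 'u) cat \<Rightarrow> ('u, 'u, 'u, 'u) func" where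
  "to_one D = const_func D one_cat undefined"

lemma to_one_functor: "category D \<Longrightarrow> is_functor D one_cat (to_one D)"
  unfolding to_one_def by (rule const_functor) (auto simp: category_one_cat, simp add: one_cat_def)

lemma to_one_unique: "category D \<Longrightarrow> is_functor D one_cat F \<Longrightarrow> F = to_one D"
  using functor_one_cat_unique to_one_functor by blast

lemma small_one_cat: "universe TYPE('u) \<Longrightarrow> small_cat (one_cat :: ('u, 'u) cat)"
  unfolding small_cat_def by (intro conjI category_one_cat small_finite) (simp_all add: one_cat_def)

definition terminal_arrow ::
  "('u, 'u) cat \<Rightarrow> ('u, 'u) cat \<Rightarrow> ('u, 'u, 'u, 'u) func \<Rightarrow> 'u cat_arrow \<times> 'u cat_arrow \<times> 'u cat_arrow"
  where "terminal_arrow E D M = ((E, D, M), (D, one_cat, to_one D), (E, one_cat, to_one E))"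

lemma terminal_arrow_Ar:
  fixes E :: "('u, 'u) cat"
  assumes "universe TYPE('u)" "small_cat E" "small_cat D" "is_functor E D M"
  shows "terminal_arrow E D M \<in> Ar (coslice Cat E)"
proof -
  have "comp_func E (to_one D) M = to_one E"
    using assms by (intro to_one_unique comp_functor[of _ D]) (auto simp: to_one_functor small_catD)
  then show ?thesis
    unfolding coslice_Cat_Ar terminal_arrow_def
    using assms by (auto simp: to_one_functor small_catD small_one_cat)
qed

lemma ex1_image_iff:
  assumes "inj f"
  shows "(\<exists>!y. y \<in> f ` X) \<longleftrightarrow> (\<exists>!x. x \<in> X)"
proof
  assume "\<exists>!y. y \<in> f ` X"
  then obtain x where "x \<in> X" "\<And>x'. x' \<in> X \<Longrightarrow> f x' = f x" by blast
  then show "\<exists>!x. x \<in> X" using injD[OF assms] by blast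
qed blast

text \<open>With a terminal object in the lower right corner, the bottom arrow of the square is
  forced and the square and the lower triangle commute automatically. What remains of a lifting
  problem is the top arrow \<open>U\<close>, and a filler is an extension of \<open>U\<close> along
  \<open>H\<close>.\<close>

lemma orthogonal_terminal_arrow_iff:
  fixes E :: "('u, 'u) cat"
  assumes u: "universe TYPE('u)"
    and f: "((E, A, F), (A, B, H), (E, B, G)) \<in> Ar (coslice Cat E)"
    and D: "small_cat D" "is_functor E D M"
  shows "orthogonal (coslice Cat E) ((E, A, F), (A, B, H), (E, B, G)) (terminal_arrow E D M) \<longleftrightarrow>
    (\<forall>U. is_functor A D U \<and> comp_func E U F = M \<longrightarrow>
      (\<exists>!W. is_functor B D W \<and> comp_func A W H = U))" (is "?orth \<longleftrightarrow> ?ext")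
proof -
  let ?K = "coslice Cat E"
  let ?f = "((E, A, F), (A, B, H), (E, B, G))"
  let ?g = "terminal_arrow E D M"
  let ?u = "\<lambda>U. ((E, A, F), (A, D, U), (E, D, M))"
  let ?w = "\<lambda>W. ((E, B, G), (B, D, W), (E, D, M))"
  let ?v = "((E, B, G), (B, one_cat, to_one B), (E, one_cat, to_one E))"
  have f': "small_cat E" "small_cat A" "small_cat B" "is_functor E A F" "is_functor E B G"
    "is_functor A B H" "comp_func E H F = G"
    using f unfolding coslice_Cat_Ar by auto
  note one = to_one_functor small_catD small_one_cat[OF u]
  have g: "Dom ?K ?g = (E, D, M)" "Cod ?K ?g = (E, one_cat, to_one E)"
    by (auto simp: coslice_def terminal_arrow_def)
  have df: "Dom ?K ?f = (E, A, F)" "Cod ?K ?f = (E, B, G)"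
    by (auto simp: coslice_def)
  have homs: "hom ?K (Dom ?K ?f) (Dom ?K ?g) = ?u ` {U. is_functor A D U \<and> comp_func E U F = M}"
    "hom ?K (Cod ?K ?f) (Dom ?K ?g) = ?w ` {W. is_functor B D W \<and> comp_func E W G = M}"
    unfolding g df using f' D by (auto simp: hom_def coslice_Cat_Ar) (auto simp: coslice_def)
  have homv: "hom ?K (Cod ?K ?f) (Cod ?K ?g) = {?v}"
  proof -
    have "?v \<in> hom ?K (Cod ?K ?f) (Cod ?K ?g)"
      unfolding g df using terminal_arrow_Ar[OF u f'(1,3,5)]
      by (auto simp: hom_def terminal_arrow_def) (auto simp: coslice_def)
    moreover have "h = ?v" if "h \<in> hom ?K (Cod ?K ?f) (Cod ?K ?g)" for h
    proof -
      have "h \<in> Ar ?K" "Dom ?K h = (E, B, G)" "Cod ?K h = (E, one_cat, to_one E)"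
        using that unfolding g df by (auto simp: hom_def)
      then obtain K where "h = ((E, B, G), (B, one_cat, K), (E, one_cat, to_one E))"
        "is_functor B one_cat K"
        unfolding coslice_Cat_Ar by (auto simp: coslice_def)
      then show ?thesis using to_one_unique f'(3) small_catD by auto
    qed
    ultimately show ?thesis by blast
  qed
  have to1: "comp_func X (to_one D) W = to_one X" if "small_cat X" "is_functor X D W" for X W
    using that D by (intro to_one_unique comp_functor[of _ D]) (auto simp: one)
  have comps: "Comp ?K ?g (?u U) = ((E, A, F), (A, one_cat, to_one A), (E, one_cat, to_one E))"
    if "is_functor A D U" for U
    using to1[OF f'(2) that] by (auto simp: coslice_def Cat_def terminal_arrow_def)
  have compw: "Comp ?K ?g (?w W) = ?v" if "is_functor B D W" for W
    using to1[OF f'(3) that] by (auto simp: coslice_def Cat_def terminal_arrow_def)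
  have compv: "Comp ?K ?v ?f = ((E, A, F), (A, one_cat, to_one A), (E, one_cat, to_one E))"
    using to_one_unique[OF _ comp_functor[OF _ f'(6) to_one_functor]] f' small_catD
    by (auto simp: coslice_def Cat_def)
  have compf: "Comp ?K (?w W) ?f = ?u (comp_func A W H)" for W
    by (auto simp: coslice_def Cat_def)
  \<comment> \<open>A filler respects the structure maps from \<open>E\<close> by associativity, so
    being an arrow of the coslice puts no further condition on \<open>W\<close>.\<close>
  have M: "comp_func E W G = M" if "comp_func A W H = U" "comp_func E U F = M" for U W
    using comp_func_assoc[OF f'(4), of W H] that f'(7) by simp
  have "?orth \<longleftrightarrow> (\<forall>U. is_functor A D U \<and> comp_func E U F = M \<longrightarrow>
      (\<exists>!d. d \<in> ?w ` {W. is_functor B D W \<and> comp_func E W G = M} \<and> Comp ?K d ?f = ?u U \<and>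
        Comp ?K ?g d = ?v))"
    unfolding orthogonal_def homs homv using comps compv by auto
  also have "\<dots> \<longleftrightarrow> ?ext"
  proof (intro all_cong1 imp_cong refl)
    fix U assume "is_functor A D U \<and> comp_func E U F = M"
    then have "d \<in> ?w ` {W. is_functor B D W \<and> comp_func E W G = M} \<and> Comp ?K d ?f = ?u U \<and>
        Comp ?K ?g d = ?v \<longleftrightarrow> d \<in> ?w ` {W. is_functor B D W \<and> comp_func A W H = U}" for d
      using compw compf M by auto
    then show "(\<exists>!d. d \<in> ?w ` {W. is_functor B D W \<and> comp_func E W G = M} \<and> Comp ?K d ?f = ?u U \<and>
        Comp ?K ?g d = ?v) \<longleftrightarrow> (\<exists>!W. is_functor B D W \<and> comp_func A W H = U)"
      using ex1_image_iff[of ?w "{W. is_functor B D W \<and> comp_func A W H = U}"] by (simp add: inj_def)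
  qed
  finally show ?thesis .
qed

text \<open>A functor \<open>U\<close> out of \<open>E[y;\<alpha>]\<close> that restricts to
  \<open>M\<close> carries \<gamma> to a cone over \<open>M C\<^sub>\<alpha>\<close> with vertex
  \<open>M y\<close>. By freeness of \<open>E[y;\<alpha>]'\<close>, an extension of \<open>U\<close>
  along \<open>r\<close> is a choice of lift of this cone, and there is exactly one lift.\<close>

lemma terminal_arrow_R_class:
  fixes S :: "('u, 'k) sketch"
  assumes u: "universe TYPE('u)" and S: "limit_sketch S" and D: "small_cat D"
    and M: "lifting_functor S D M"
  shows "terminal_arrow (base S) D M \<in> R_class S"
proof -
  let ?E = "base S"
  have E: "small_cat ?E" and M': "is_functor ?E D M"
    using S M by (auto simp: limit_sketch_def lifting_functor_def)
  have "orthogonal (coslice Cat ?E) h (terminal_arrow ?E D M)" if "h \<in> Xi S" for h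
  proof -
    obtain y \<alpha> A i \<gamma> B r f where h: "h = ((?E, A, i), (A, B, r), (?E, B, comp_func ?E r i))"
      and y: "y \<in> Ob ?E" and \<alpha>: "\<alpha> \<in> labels S"
      and init: "initial_cone_triple ?E (cones S \<alpha>) y A i \<gamma>"
      and free: "free_cone_lift (cones S \<alpha>) y A i \<gamma> B r f"
      using \<open>h \<in> Xi S\<close> unfolding Xi_def by blast
    define C where "C = cones S \<alpha>"
    have C: "is_cone ?E C" using S \<alpha> by (auto simp: limit_sketch_def C_def)
    note C' = is_coneD[OF C]
    have A: "small_cat A" "is_functor ?E A i"
      and \<gamma>: "nat_trans (index C) A (comp_func (index C) i (const_func (index C) ?E y))
        (comp_func (index C) i (diagram C)) \<gamma>"
      using init unfolding initial_cone_triple_def cone_triple_def C_def by auto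
    have lift: "cone_lift C y A i \<gamma> B r f" using free unfolding free_cone_lift_def C_def by auto
    have B: "small_cat B" "is_functor A B r" using lift unfolding cone_lift_def by auto
    have h_Ar: "((?E, A, i), (A, B, r), (?E, B, comp_func ?E r i)) \<in> Ar (coslice Cat ?E)"
      unfolding coslice_Cat_Ar using E A B comp_functor[OF small_catD[OF E] A(2) B(2)] by blast
    \<comment> \<open>\<open>cone_triple\<close> starts from the image under \<open>i\<close> of a
      constant functor. As \<open>i\<close> preserves identities, this is constant again, so the
      description of cones by \<open>nat_trans_const_iff\<close> applies to \<gamma>.\<close>
    have const: "comp_func (index C) i (const_func (index C) ?E y) = const_func (index C) A (omap i y)"
      unfolding comp_func_def using functor_Id[OF A(2) y]
      by (simp add: const_func_def cong: restrict_cong)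
    have "\<exists>!W. is_functor B D W \<and> comp_func A W r = U"
      if U: "is_functor A D U" "comp_func ?E U i = M" for U
    proof -
      have Ui: "omap U (omap i x) = omap M x" if "x \<in> Ob ?E" for x
        using that U(2) by force
      have Ui': "amap U (amap i g) = amap M g" if "g \<in> Ar ?E" for g
        using that U(2) by force
      have \<gamma>': "\<And>k. k \<in> Ob (index C) \<Longrightarrow> \<gamma> k \<in> hom A (omap i y) (omap i (omap (diagram C) k))"
        "\<And>j. j \<in> Ar (index C) \<Longrightarrow>
          Comp A (amap i (amap (diagram C) j)) (\<gamma> (Dom (index C) j)) = \<gamma> (Cod (index C) j)"
        using \<gamma> unfolding const nat_trans_const_iff[OF C'(3) small_catD[OF A(1)]] by auto
      have over: "cone_over D M C (omap M y) (\<lambda>k. amap U (\<gamma> k))"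
        unfolding cone_over_def
      proof (intro conjI ballI)
        fix k assume k: "k \<in> Ob (index C)"
        show "amap U (\<gamma> k) \<in> hom D (omap M y) (omap M (omap (diagram C) k))"
          using functor_hom[OF U(1) \<gamma>'(1)[OF k]] Ui y functor_Ob[OF C'(4) k] by simp
      next
        fix j assume j: "j \<in> Ar (index C)"
        show "Comp D (amap M (amap (diagram C) j)) (amap U (\<gamma> (Dom (index C) j)))
            = amap U (\<gamma> (Cod (index C) j))"
          using functor_Comp[OF U(1) functor_hom[OF A(2) cone_diagram_hom[OF C j]]
              \<gamma>'(1)[OF Dom_Ob[OF C'(3) j]]]
            \<gamma>'(2)[OF j] Ui' functor_Ar(1)[OF C'(4) j] by simp
      qed
      have lift_iff: "cone_lift C y A i \<gamma> D U v \<longleftrightarrow> is_lift D M C (omap M y) (\<lambda>k. amap U (\<gamma> k)) v" for v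
        unfolding cone_lift_def is_lift_def
        using D U(1) Ui y C'(1) Ui' homD(1)[OF cone_legs(1)[OF small_catD[OF E] C]] by auto
      have "unique_lifts D M C (omap M y)"
        using M y \<alpha> unfolding lifting_functor_def C_def by blast
      then have "\<exists>!v. cone_lift C y A i \<gamma> D U v"
        using over unfolding unique_lifts_def lift_iff by blast
      then obtain v where v: "cone_lift C y A i \<gamma> D U v" "\<And>v'. cone_lift C y A i \<gamma> D U v' \<Longrightarrow> v' = v"
        by blast
      \<comment> \<open>Freeness yields uniqueness only among the \<open>W\<close> with
        \<open>amap W f = v\<close>. Every extension satisfies this, because it sends
        \<open>f\<close> to a lift of the same cone.\<close>
      have "amap W f = v" if W: "is_functor B D W" "comp_func A W r = U" for W
      proof (rule v(2))
        have Wr: "omap W (omap r x) = omap U x" if "x \<in> Ob A" for x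
          using that W(2) by force
        have Wr': "amap W (amap r g) = amap U g" if "g \<in> Ar A" for g
          using that W(2) by force
        have "f \<in> hom B (omap r (omap i y)) (omap r (omap i (vertex C)))"
          using lift by (auto simp: cone_lift_def)
        then have "amap W f \<in> hom D (omap U (omap i y)) (omap U (omap i (vertex C)))"
          using functor_hom[OF W(1)] Wr functor_Ob[OF A(2)] y C'(1) by metis
        moreover have "Comp D (amap U (amap i (legs C k))) (amap W f) = amap U (\<gamma> k)"
          if k: "k \<in> Ob (index C)" for k
        proof -
          note leg = functor_hom[OF A(2) cone_legs(1)[OF small_catD[OF E] C k]]
          show ?thesis
            using functor_Comp[OF W(1) functor_hom[OF B(2) leg], of f] lift k Wr' homD(1)[OF leg]
              homD(1)[OF \<gamma>'(1)[OF k]]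
            by (auto simp: cone_lift_def)
        qed
        ultimately show "cone_lift C y A i \<gamma> D U (amap W f)"
          unfolding cone_lift_def using D U(1) by blast
      qed
      moreover have "\<exists>!W. is_functor B D W \<and> comp_func A W r = U \<and> amap W f = v"
        using free v(1) unfolding free_cone_lift_def C_def by blast
      ultimately show ?thesis by blast
    qed
    then show ?thesis
      unfolding h orthogonal_terminal_arrow_iff[OF u h_Ar D M'] by blast
  qed
  then show ?thesis
    unfolding R_class_def right_orth_def using terminal_arrow_Ar[OF u E D M'] by blast
qed

text \<open>\<open>bang\<close> starts at the initial object, whose structure map is the identity of
  \<open>E\<close>. So the functor underlying the left factor, composed with the identity, is the
  structure map \<open>L\<close> of its codomain; hence it equals \<open>L\<close>.\<close>

lemma bang_factorizationD:
  fixes S :: "('u, 'k) sketch"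
  assumes "limit_sketch S" "bang_factorization S Fib L"
  shows "small_cat Fib" "is_functor (base S) Fib L"
    "((base S, base S, id_func (base S)), (base S, Fib, L), (base S, Fib, L)) \<in> L_class S"
proof -
  let ?E = "base S"
  obtain l r where l: "l \<in> L_class S" "Cod (coslice Cat ?E) l = (?E, Fib, L)"
    and r: "r \<in> R_class S" "Comp (coslice Cat ?E) r l = bang ?E"
    using assms(2) unfolding bang_factorization_def by blast
  have "l \<in> Ar (coslice Cat ?E)" "r \<in> Ar (coslice Cat ?E)"
    using l r unfolding L_class_def R_class_def left_orth_def right_orth_def by auto
  then obtain A F B G H A' F' B' G' H' where
    l': "l = ((?E, A, F), (A, B, H), (?E, B, G))" "small_cat B" "is_functor ?E B G"
      "is_functor A B H" "comp_func ?E H F = G" and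
    r': "r = ((?E, A', F'), (A', B', H'), (?E, B', G'))"
    unfolding coslice_Cat_Ar by (elim exE conjE) blast
  have B: "B = Fib" "G = L"
    using l(2) unfolding l' by (auto simp: coslice_def)
  have A: "A = ?E" "F = id_func ?E"
    using r(2) unfolding l' r' bang_def Let_def by (auto simp: coslice_def)
  have "H = L"
    using comp_id_func(1)[of ?E B H] l'(4,5) A B by simp
  then show "small_cat Fib" "is_functor ?E Fib L"
    "((?E, ?E, id_func ?E), (?E, Fib, L), (?E, Fib, L)) \<in> L_class S"
    using l(1) l' A B by auto
qed

text \<open>\<open>L\<close> is orthogonal to \<open>terminal_arrow E D M\<close>. Since
  \<open>L\<close> is here an arrow out of the identity of \<open>E\<close>, the only possible top
  side of the square is \<open>M\<close> itself.\<close>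

lemma small_extension:
  fixes S :: "('u, 'k) sketch" and D :: "('u, 'u) cat"
  assumes u: "universe TYPE('u)" and S: "limit_sketch S" and fact: "bang_factorization S Fib L"
    and D: "small_cat D" and M: "lifting_functor S D M"
  shows "\<exists>!N. is_functor Fib D N \<and> comp_func (base S) N L = M"
proof -
  let ?E = "base S"
  let ?l = "((?E, ?E, id_func ?E), (?E, Fib, L), (?E, Fib, L))"
  have M': "is_functor ?E D M" using M by (simp add: lifting_functor_def)
  have "?l \<in> L_class S" by (rule bang_factorizationD(3)[OF S fact])
  then have l: "?l \<in> Ar (coslice Cat ?E)"
    and "orthogonal (coslice Cat ?E) ?l (terminal_arrow ?E D M)"
    using terminal_arrow_R_class[OF u S D M] unfolding L_class_def left_orth_def by auto
  then show ?thesis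
    unfolding orthogonal_terminal_arrow_iff[OF u l D M'] using comp_id_func(1)[OF M'] M' by blast
qed

section \<open>Extension of lifting functors into arbitrary categories\<close>

text \<open>Objects of \<open>Cat\<close> have their objects and arrows in \<open>'u\<close>, so a
  small category over other types must be transported along injections into \<open>'u\<close>. The
  comparison functors are strict inverses because extensions have to agree as functors, not up to
  isomorphism.\<close>

lemma small_copy:
  fixes D :: "('o, 'a) cat"
  assumes D: "category D" and small: "small TYPE('u) (Ob D)" "small TYPE('u) (Ar D)"
  obtains D' :: "('u, 'u) cat" and J K where "small_cat D'" "is_functor D' D J" "is_functor D D' K"
    "comp_func D J K = id_func D" "comp_func D' K J = id_func D'"
proof -
  obtain eo :: "'o \<Rightarrow> 'u" where eo: "inj_on eo (Ob D)" using small(1) by (rule small_inj_into)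
  obtain ea :: "'a \<Rightarrow> 'u" where ea: "inj_on ea (Ar D)" using small(2) by (rule small_inj_into)
  define io ia where "io = inv_into (Ob D) eo" and "ia = inv_into (Ar D) ea"
  have io [simp]: "x \<in> Ob D \<Longrightarrow> io (eo x) = x" for x using eo by (simp add: io_def)
  have ia [simp]: "f \<in> Ar D \<Longrightarrow> ia (ea f) = f" for f using ea by (simp add: ia_def)
  define D' where "D' = \<lparr>Ob = eo ` Ob D, Ar = ea ` Ar D, Dom = \<lambda>f. eo (Dom D (ia f)),
    Cod = \<lambda>f. eo (Cod D (ia f)), Id = \<lambda>x. ea (Id D (io x)), Comp = \<lambda>g f. ea (Comp D (ia g) (ia f))\<rparr>"
  define J where "J = \<lparr>omap = restrict io (Ob D'), amap = restrict ia (Ar D')\<rparr>"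
  define K where "K = \<lparr>omap = restrict eo (Ob D), amap = restrict ea (Ar D)\<rparr>"
  have eo_eq [simp]: "x \<in> Ob D \<Longrightarrow> y \<in> Ob D \<Longrightarrow> eo x = eo y \<longleftrightarrow> x = y" for x y
    using eo by (auto dest: inj_onD)
  have ea_eq [simp]: "f \<in> Ar D \<Longrightarrow> g \<in> Ar D \<Longrightarrow> ea f = ea g \<longleftrightarrow> f = g" for f g
    using ea by (auto dest: inj_onD)
  note [simp] = Dom_Ob[OF D] Cod_Ob[OF D] Comp_Ar[OF D]
  have Id [simp]: "x \<in> Ob D \<Longrightarrow> Id D x \<in> Ar D \<and> Dom D (Id D x) = x \<and> Cod D (Id D x) = x" for x
    using Id_hom[OF D] homD by metis
  have "category D'"
    using D unfolding category_def by (auto simp: D'_def hom_def)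
  moreover have "small TYPE('u) (Ob D')" "small TYPE('u) (Ar D')"
    using small small_image by (auto simp: D'_def)
  moreover have "is_functor D' D J"
    by (rule is_functorI) (auto simp: J_def D'_def hom_def)
  moreover have "is_functor D D' K"
    by (rule is_functorI) (auto simp: K_def D'_def hom_def)
  moreover have "comp_func D J K = id_func D"
    by (auto simp: comp_func_def id_func_def J_def K_def D'_def intro!: restrict_ext)
  moreover have "comp_func D' K J = id_func D'"
    by (auto simp: comp_func_def id_func_def J_def K_def D'_def intro!: restrict_ext)
  ultimately show ?thesis using that unfolding small_cat_def by blast
qed

lemma map_cone_over:
  assumes "category E" "is_cone E C" "is_functor E D M" "is_functor D D' F"
    and "cone_over D M C d \<psi>"
  shows "cone_over D' (comp_func E F M) C (omap F d) (\<lambda>i. amap F (\<psi> i))"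
proof -
  note C = is_coneD[OF assms(2)]
  have \<psi>: "\<And>i. i \<in> Ob (index C) \<Longrightarrow> \<psi> i \<in> hom D d (omap M (omap (diagram C) i))"
    "\<And>j. j \<in> Ar (index C) \<Longrightarrow> Comp D (amap M (amap (diagram C) j)) (\<psi> (Dom (index C) j))
       = \<psi> (Cod (index C) j)"
    using assms(5) by (auto simp: cone_over_def)
  have "Comp D' (amap F (amap M (amap (diagram C) j))) (amap F (\<psi> (Dom (index C) j)))
       = amap F (\<psi> (Cod (index C) j))" if j: "j \<in> Ar (index C)" for j
    using functor_Comp[OF assms(4) functor_hom[OF assms(3) cone_diagram_hom[OF assms(2) j]]
        \<psi>(1)[OF Dom_Ob[OF C(3) j]]] \<psi>(2)[OF j] by simp
  then show ?thesis
    using functor_hom[OF assms(4) \<psi>(1)] functor_Ob[OF C(4)] functor_Ar[OF C(4)]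
    by (simp add: cone_over_def)
qed

lemma map_lift:
  assumes "category E" "is_cone E C" "is_functor E D M" "is_functor D D' F"
    and "is_lift D M C d \<psi> u"
  shows "is_lift D' (comp_func E F M) C (omap F d) (\<lambda>i. amap F (\<psi> i)) (amap F u)"
proof -
  note C = is_coneD[OF assms(2)]
  have u: "u \<in> hom D d (omap M (vertex C))"
    "\<And>i. i \<in> Ob (index C) \<Longrightarrow> Comp D (amap M (legs C i)) u = \<psi> i"
    using assms(5) by (auto simp: is_lift_def)
  show ?thesis
    using functor_Comp[OF assms(4) functor_hom[OF assms(3) cone_legs(1)[OF assms(1,2)]] u(1)] u(2)
      functor_hom[OF assms(4) u(1)] C(1) homD(1)[OF cone_legs(1)[OF assms(1,2)]]
    by (simp add: is_lift_def)
qed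

lemma limit_sketchD:
  assumes "limit_sketch S"
  shows "category (base S)" "\<And>\<alpha>. \<alpha> \<in> labels S \<Longrightarrow> is_cone (base S) (cones S \<alpha>)"
  using assms by (auto simp: limit_sketch_def small_cat_def)

text \<open>A lifting problem in \<open>D'\<close> is sent to \<open>D\<close> by \<open>J\<close>,
  solved there and brought back by \<open>K\<close>. Strictness of the two inverse laws ensures that
  this solves the original problem.\<close>

lemma lifting_functor_iso:
  assumes S: "limit_sketch S" and M: "lifting_functor S D M"
    and J: "is_functor D' D J" and K: "is_functor D D' K"
    and JK: "comp_func D J K = id_func D" and KJ: "comp_func D' K J = id_func D'"
  shows "lifting_functor S D' (comp_func (base S) K M)"
  unfolding lifting_functor_def
proof (intro conjI ballI)
  let ?E = "base S" and ?M = "comp_func (base S) K M"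
  have M': "is_functor ?E D M" using M by (simp add: lifting_functor_def)
  then show M'': "is_functor ?E D' ?M"
    using limit_sketchD(1)[OF S] K by (intro comp_functor)
  fix y \<alpha> assume y: "y \<in> Ob ?E" and \<alpha>: "\<alpha> \<in> labels S"
  let ?C = "cones S \<alpha>"
  note C = limit_sketchD(2)[OF S \<alpha>]
  have JKM: "comp_func ?E J ?M = M"
    using comp_func_assoc[OF M', of J K] JK comp_id_func(2)[OF M'] by simp
  have Jy: "omap J (omap ?M y) = omap M y"
    using arg_cong[OF JKM, of "\<lambda>F. omap F y"] y by simp
  have KJf: "amap K (amap J f) = f" if "f \<in> Ar D'" for f
    using arg_cong[OF KJ, of "\<lambda>F. amap F f"] that by simp
  have My: "omap K (omap M y) = omap ?M y" using y by simp
  show "unique_lifts D' ?M ?C (omap ?M y)"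
    unfolding unique_lifts_def
  proof (intro allI impI)
    fix \<psi> assume over: "cone_over D' ?M ?C (omap ?M y) \<psi>"
    then have \<psi>: "\<psi> i \<in> Ar D'" if "i \<in> Ob (index ?C)" for i
      using that by (auto simp: cone_over_def hom_def)
    have to: "is_lift D M ?C (omap M y) (\<lambda>i. amap J (\<psi> i)) (amap J v)"
      if "is_lift D' ?M ?C (omap ?M y) \<psi> v" for v
      using map_lift[OF limit_sketchD(1)[OF S] C M'' J that] unfolding JKM Jy .
    have "cone_over D M ?C (omap M y) (\<lambda>i. amap J (\<psi> i))"
      using map_cone_over[OF limit_sketchD(1)[OF S] C M'' J over] unfolding JKM Jy .
    then obtain u where u: "is_lift D M ?C (omap M y) (\<lambda>i. amap J (\<psi> i)) u"
      and unique: "\<And>u'. is_lift D M ?C (omap M y) (\<lambda>i. amap J (\<psi> i)) u' \<Longrightarrow> u' = u"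
      using M y \<alpha> unfolding lifting_functor_def unique_lifts_def by (metis (no_types, lifting))
    have "is_lift D' ?M ?C (omap ?M y) (\<lambda>i. amap K (amap J (\<psi> i))) (amap K u)"
      using map_lift[OF limit_sketchD(1)[OF S] C M' K u] unfolding My .
    then have "is_lift D' ?M ?C (omap ?M y) \<psi> (amap K u)"
      using KJf \<psi> by (simp add: is_lift_def)
    moreover have "v = amap K u" if "is_lift D' ?M ?C (omap ?M y) \<psi> v" for v
      using unique[OF to[OF that]] KJf[of v] that by (auto simp: is_lift_def hom_def)
    ultimately show "\<exists>!v. is_lift D' ?M ?C (omap ?M y) \<psi> v" by blast
  qed
qed

lemma essentially_small_extension:
  fixes S :: "('u, 'k) sketch" and D :: "('o, 'a) cat"
  assumes u: "universe TYPE('u)" and S: "limit_sketch S" and fact: "bang_factorization S Fib L"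
    and D: "category D" "small TYPE('u) (Ob D)" "small TYPE('u) (Ar D)"
    and M: "lifting_functor S D M"
  shows "\<exists>!N. is_functor Fib D N \<and> comp_func (base S) N L = M"
proof -
  let ?E = "base S"
  have L: "is_functor ?E Fib L" and Fib: "category Fib"
    using bang_factorizationD[OF S fact] small_catD by auto
  have M': "is_functor ?E D M" using M by (simp add: lifting_functor_def)
  obtain D' :: "('u, 'u) cat" and J K where D': "small_cat D'" and J: "is_functor D' D J"
    and K: "is_functor D D' K" and JK: "comp_func D J K = id_func D"
    and KJ: "comp_func D' K J = id_func D'"
    using D by (rule small_copy)
  have "\<exists>!N. is_functor Fib D' N \<and> comp_func ?E N L = comp_func ?E K M"
    using small_extension[OF u S fact D' lifting_functor_iso[OF S M J K JK KJ]] .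
  then obtain N where N: "is_functor Fib D' N" "comp_func ?E N L = comp_func ?E K M"
    and unique: "\<And>N'. is_functor Fib D' N' \<Longrightarrow> comp_func ?E N' L = comp_func ?E K M \<Longrightarrow> N' = N"
    by blast
  show ?thesis
  proof (rule ex1I[of _ "comp_func Fib J N"])
    have "comp_func ?E (comp_func Fib J N) L = comp_func ?E (comp_func D J K) M"
      by (simp add: comp_func_assoc[OF L] comp_func_assoc[OF M'] N(2))
    then show "is_functor Fib D (comp_func Fib J N) \<and> comp_func ?E (comp_func Fib J N) L = M"
      using comp_functor[OF Fib N(1) J] JK comp_id_func(2)[OF M'] by simp
  next
    fix N' assume N': "is_functor Fib D N' \<and> comp_func ?E N' L = M"
    then have "comp_func Fib K N' = N"
      by (intro unique comp_functor[OF Fib _ K]) (auto simp: comp_func_assoc[OF L])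
    then show "N' = comp_func Fib J N"
      using comp_func_assoc[of Fib D N' J K] JK comp_id_func(2)[of Fib D N'] N' by auto
  qed
qed

section \<open>A small subcategory closed under lifts\<close>

datatype ('a, 'y, 'k) closure_rule = Gen 'a | Composite | Lift 'y 'k

text \<open>The sum type gives all rules one type of premise names: \<open>Inl i\<close> is the leg
  of a cone at \<open>i\<close>, \<open>Inr True\<close> and \<open>Inr False\<close> are the second
  and the first factor of a composite.\<close>

fun rule_arity :: "('u, 'k) sketch \<Rightarrow> ('a, 'u, 'k) closure_rule \<Rightarrow> ('u + bool) set" where
  "rule_arity S (Gen a) = {}"
| "rule_arity S Composite = {Inr True, Inr False}"
| "rule_arity S (Lift y \<alpha>) = Inl ` Ob (index (cones S \<alpha>))"

text \<open>The \<open>Lift\<close> rule asks for a lift but not for a cone: by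
  \<open>cone_over_lift\<close> a family with a lift is a cone on the objects of the index
  category.\<close>

fun rule_result ::
  "('u, 'k) sketch \<Rightarrow> ('o, 'a) cat \<Rightarrow> ('u, 'u, 'o, 'a) func \<Rightarrow> ('a, 'u, 'k) closure_rule \<Rightarrow>
    ('u + bool \<Rightarrow> 'a) \<Rightarrow> 'a \<Rightarrow> bool" where
  "rule_result S D M (Gen a) f b \<longleftrightarrow> b = a"
| "rule_result S D M Composite f b \<longleftrightarrow> Cod D (f (Inr False)) = Dom D (f (Inr True)) \<and>
     b = Comp D (f (Inr True)) (f (Inr False))"
| "rule_result S D M (Lift y \<alpha>) f b \<longleftrightarrow> is_lift D M (cones S \<alpha>) (omap M y) (\<lambda>i. f (Inl i)) b"

text \<open>This makes the \<open>Lift\<close> rule functional. Replacing \<psi> by the family that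
  \<open>u\<close> induces changes it only off the index objects and turns it into a cone, to which
  unique lifting applies.\<close>

lemma lift_unique:
  assumes "limit_sketch S" "category D" "lifting_functor S D M" "y \<in> Ob (base S)" "\<alpha> \<in> labels S"
    and "is_lift D M (cones S \<alpha>) (omap M y) \<psi> u" "is_lift D M (cones S \<alpha>) (omap M y) \<psi> v"
  shows "u = v"
proof -
  let ?\<psi> = "\<lambda>i. Comp D (amap M (legs (cones S \<alpha>) i)) u"
  have "cone_over D M (cones S \<alpha>) (omap M y) ?\<psi>"
    using assms by (intro cone_over_lift[of D "base S"])
      (auto simp: limit_sketchD lifting_functor_def is_lift_def)
  then have "\<exists>!u. is_lift D M (cones S \<alpha>) (omap M y) ?\<psi> u"
    using assms unfolding lifting_functor_def unique_lifts_def by blast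
  moreover have "is_lift D M (cones S \<alpha>) (omap M y) ?\<psi> u" "is_lift D M (cones S \<alpha>) (omap M y) ?\<psi> v"
    using assms(6,7) by (auto simp: is_lift_def)
  ultimately show ?thesis by blast
qed

text \<open>The object set \<open>X\<close> is fixed in advance and only arrows are generated.
  \<open>X\<close> and \<open>Y\<close> are left free so that the subcategory can be made to contain
  the images of further functors, as the uniqueness of extensions requires.\<close>

lemma small_lifting_subcategory:
  fixes S :: "('u, 'k) sketch" and D :: "('o, 'a) cat"
  assumes u: "universe TYPE('u)" and S: "limit_sketch S" and D: "category D"
    and M: "lifting_functor S D M"
    and X: "X \<subseteq> Ob D" "small TYPE('u) X" "omap M ` Ob (base S) \<subseteq> X"
    and Y: "Y \<subseteq> Ar D" "small TYPE('u) Y" "amap M ` Ar (base S) \<subseteq> Y"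
    and XY: "Dom D ` Y \<subseteq> X" "Cod D ` Y \<subseteq> X"
  obtains Z where "Y \<subseteq> Z" "Z \<subseteq> Ar D" "small TYPE('u) Z" "category (D\<lparr>Ob := X, Ar := Z\<rparr>)"
    "lifting_functor S (D\<lparr>Ob := X, Ar := Z\<rparr>) M"
proof -
  let ?E = "base S"
  \<comment> \<open>Identities on \<open>X\<close> enter as generators. Composites and lifts stay
    between objects of \<open>X\<close>, since a lift runs from \<open>M y\<close> to the image
    under \<open>M\<close> of a vertex.\<close>
  define \<Lambda> where "\<Lambda> = Gen ` (Y \<union> Id D ` X) \<union> {Composite} \<union> (\<lambda>(y, \<alpha>). Lift y \<alpha>) ` (Ob ?E \<times> labels S)"
  define Z where "Z = gen_closure \<Lambda> (rule_arity S) (rule_result S D M)"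
  have M': "is_functor ?E D M" using M by (simp add: lifting_functor_def)
  have Sk: "small TYPE('u) (Ob ?E)" "small TYPE('u) (labels S)"
    "\<And>\<alpha>. \<alpha> \<in> labels S \<Longrightarrow> is_cone ?E (cones S \<alpha>)"
    "\<And>\<alpha>. \<alpha> \<in> labels S \<Longrightarrow> small TYPE('u) (Ob (index (cones S \<alpha>)))"
    using S unfolding limit_sketch_def small_cat_def is_cone_def by auto
  \<comment> \<open>The premise family may be arbitrary off the arity of the rule.
    \<open>Gen\<close> has no premises, which permits \<open>undefined\<close>; the two
    \<open>case_sum\<close> families below are likewise filled in only where their rule reads
    them.\<close>
  have gen: "a \<in> Z" if "a \<in> Y \<union> Id D ` X" for a
    unfolding Z_def by (rule gen_closure.rule[of "Gen a" _ _ undefined]) (use that in \<open>auto simp: \<Lambda>_def\<close>)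
  have comp: "Comp D g f \<in> Z" if "f \<in> Z" "g \<in> Z" "Cod D f = Dom D g" for f g
    unfolding Z_def
    by (rule gen_closure.rule[of Composite _ _ "case_sum undefined (\<lambda>b. if b then g else f)"])
      (use that in \<open>auto simp: \<Lambda>_def Z_def\<close>)
  have lift: "b \<in> Z" if "y \<in> Ob ?E" "\<alpha> \<in> labels S" "\<And>i. i \<in> Ob (index (cones S \<alpha>)) \<Longrightarrow> \<psi> i \<in> Z"
    "is_lift D M (cones S \<alpha>) (omap M y) \<psi> b" for y \<alpha> \<psi> b
    unfolding Z_def
    by (rule gen_closure.rule[of "Lift y \<alpha>" _ _ "case_sum \<psi> undefined"])
      (use that in \<open>auto simp: \<Lambda>_def Z_def\<close>)
  have Z: "a \<in> Ar D \<and> Dom D a \<in> X \<and> Cod D a \<in> X" if "a \<in> Z" for a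
    using that unfolding Z_def
  proof induction
    case (rule l f a)
    show ?case
    proof (cases l)
      case (Gen b)
      then have "a \<in> Y \<union> Id D ` X" using rule.hyps(1,3) by (auto simp: \<Lambda>_def)
      then show ?thesis
      proof
        assume "a \<in> Id D ` X"
        then obtain x where "x \<in> X" "a = Id D x" by blast
        then show ?thesis using X(1) homD[OF Id_hom[OF D, of x]] by auto
      qed (use Y(1) XY in blast)
    next
      case Composite
      then show ?thesis using rule.hyps(3) rule.IH Comp_Ar[OF D] by simp
    next
      case (Lift y \<alpha>)
      then show ?thesis
        using rule.hyps(1,3) is_coneD(1)[OF Sk(3)] X(3) by (auto simp: \<Lambda>_def is_lift_def hom_def)
    qed
  qed
  have "small TYPE('u) Z"
    unfolding Z_def
  proof (rule small_gen_closure[OF u])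
    show "small TYPE('u) \<Lambda>"
      unfolding \<Lambda>_def by (intro small_Un[OF u] small_image small_finite[OF u] small_Sigma[OF u] X Y Sk) auto
    show "small TYPE('u) (rule_arity S l)" if "l \<in> \<Lambda>" for l
      using that Sk(4) small_finite[OF u] small_image by (cases l) (auto simp: \<Lambda>_def)
    show "\<forall>l\<in>\<Lambda>. \<forall>f g a a'. rule_result S D M l f a \<longrightarrow> rule_result S D M l g a' \<longrightarrow>
        (\<forall>b\<in>rule_arity S l. f b = g b) \<longrightarrow> a = a'"
    proof (intro ballI allI impI)
      fix l f g a a'
      assume l: "l \<in> \<Lambda>" "rule_result S D M l f a" "rule_result S D M l g a'"
        and eq: "\<forall>b\<in>rule_arity S l. f b = g b"
      show "a = a'"
      proof (cases l)
        case (Lift y \<alpha>)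
        then have "is_lift D M (cones S \<alpha>) (omap M y) (\<lambda>i. f (Inl i)) a'"
          using l(3) eq by (auto simp: is_lift_def)
        then show ?thesis using lift_unique[OF S D M] l(1,2) Lift by (auto simp: \<Lambda>_def)
      qed (use l eq in auto)
    qed
  qed
  moreover have Y_Z: "Y \<subseteq> Z" "Z \<subseteq> Ar D" using gen Z by auto
  moreover have "category (D\<lparr>Ob := X, Ar := Z\<rparr>)"
    using Z gen comp by (intro category_subcat D X) auto
  moreover have "lifting_functor S (D\<lparr>Ob := X, Ar := Z\<rparr>) M"
    unfolding lifting_functor_def functor_subcat_iff[OF X(1) Y_Z(2)]
  proof (intro conjI ballI)
    fix y \<alpha> assume y: "y \<in> Ob ?E" and \<alpha>: "\<alpha> \<in> labels S"
    let ?D = "D\<lparr>Ob := X, Ar := Z\<rparr>" and ?C = "cones S \<alpha>"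
    have hom: "f \<in> hom ?D a b \<longleftrightarrow> f \<in> hom D a b \<and> f \<in> Z" for f a b
      using hom_subcat[OF Y_Z(2)] by simp
    show "unique_lifts ?D M ?C (omap M y)"
      unfolding unique_lifts_def
    proof (intro allI impI)
      fix \<psi> assume \<psi>: "cone_over ?D M ?C (omap M y) \<psi>"
      then have "cone_over D M ?C (omap M y) \<psi>" and \<psi>_Z: "\<And>i. i \<in> Ob (index ?C) \<Longrightarrow> \<psi> i \<in> Z"
        by (auto simp: cone_over_def hom)
      then have "\<exists>!v. is_lift D M ?C (omap M y) \<psi> v"
        using M y \<alpha> unfolding lifting_functor_def unique_lifts_def by blast
      \<comment> \<open>The legs lie in \<open>Z\<close>, so the \<open>Lift\<close> rule puts every
        lift formed in \<open>D\<close> into \<open>Z\<close>. Both categories therefore pose the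
        same problem with the same solutions.\<close>
      moreover have "is_lift ?D M ?C (omap M y) \<psi> v \<longleftrightarrow> is_lift D M ?C (omap M y) \<psi> v" for v
        using lift[OF y \<alpha> \<psi>_Z] by (auto simp: is_lift_def hom)
      ultimately show "\<exists>!v. is_lift ?D M ?C (omap M y) \<psi> v" by simp
    qed
  qed (use M' X Y Y_Z in auto)
  ultimately show ?thesis using that by blast
qed

text \<open>The extension is built in the subcategory generated by the image of \<open>M\<close>,
  and is then read as a functor into \<open>D\<close>. Uniqueness obtained there covers only
  functors that land in that subcategory, so it needs a second choice.\<close>

theorem extension:
  fixes S :: "('u, 'k) sketch" and D :: "('o, 'a) cat"
  assumes u: "universe TYPE('u)" and S: "limit_sketch S" and fact: "bang_factorization S Fib L"
    and D: "category D" and M: "lifting_functor S D M"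
  shows "\<exists>!N. is_functor Fib D N \<and> comp_func (base S) N L = M"
proof -
  let ?E = "base S"
  have M': "is_functor ?E D M" using M by (simp add: lifting_functor_def)
  have E: "small_cat ?E" using S by (simp add: limit_sketch_def)
  note Fib = bang_factorizationD(1)[OF S fact]
  have small: "small TYPE('u) (Ob ?E)" "small TYPE('u) (Ar ?E)" "small TYPE('u) (Ob Fib)" "small TYPE('u) (Ar Fib)"
    using E Fib by (auto simp: small_cat_def)
  have ext: "\<exists>Z. Y \<subseteq> Z \<and> Z \<subseteq> Ar D \<and> (\<exists>!N. is_functor Fib (D\<lparr>Ob := X, Ar := Z\<rparr>) N \<and> comp_func ?E N L = M)"
    if X: "X \<subseteq> Ob D" "small TYPE('u) X" "omap M ` Ob ?E \<subseteq> X"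
    and Y: "Y \<subseteq> Ar D" "small TYPE('u) Y" "amap M ` Ar ?E \<subseteq> Y"
    and XY: "Dom D ` Y \<subseteq> X" "Cod D ` Y \<subseteq> X" for X Y
  proof -
    obtain Z where Z: "Y \<subseteq> Z" "Z \<subseteq> Ar D" "small TYPE('u) Z" "category (D\<lparr>Ob := X, Ar := Z\<rparr>)"
      "lifting_functor S (D\<lparr>Ob := X, Ar := Z\<rparr>) M"
      using u S D M X Y XY by (rule small_lifting_subcategory)
    moreover have "\<exists>!N. is_functor Fib (D\<lparr>Ob := X, Ar := Z\<rparr>) N \<and> comp_func ?E N L = M"
      using essentially_small_extension[OF u S fact Z(4) _ _ Z(5)] X(2) Z(3) by simp
    ultimately show ?thesis by blast
  qed
  have "\<exists>N. is_functor Fib D N \<and> comp_func ?E N L = M"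
  proof -
    have "\<exists>Z. amap M ` Ar ?E \<subseteq> Z \<and> Z \<subseteq> Ar D \<and>
        (\<exists>!N. is_functor Fib (D\<lparr>Ob := omap M ` Ob ?E, Ar := Z\<rparr>) N \<and> comp_func ?E N L = M)"
      by (rule ext) (use functor_Ob[OF M'] functor_Ar[OF M'] small(1,2)[THEN small_image]
        Dom_Ob[OF small_catD[OF E]] Cod_Ob[OF small_catD[OF E]] in auto)
    then obtain Z where "Z \<subseteq> Ar D"
      "\<exists>!N. is_functor Fib (D\<lparr>Ob := omap M ` Ob ?E, Ar := Z\<rparr>) N \<and> comp_func ?E N L = M"
      by blast
    then show ?thesis using functor_subcat_iff[of "omap M ` Ob ?E" D Z] functor_Ob[OF M'] by blast
  qed
  \<comment> \<open>Two competing extensions have small images, as \<open>Fib\<close> is small. A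
    subcategory generated by these images and that of \<open>M\<close> contains both extensions, and
    uniqueness inside it applies.\<close>
  moreover have "N = N'"
    if N: "is_functor Fib D N" "comp_func ?E N L = M" "is_functor Fib D N'" "comp_func ?E N' L = M"
    for N N'
  proof -
    let ?X = "omap M ` Ob ?E \<union> omap N ` Ob Fib \<union> omap N' ` Ob Fib"
    let ?Y = "amap M ` Ar ?E \<union> amap N ` Ar Fib \<union> amap N' ` Ar Fib"
    have X: "?X \<subseteq> Ob D" using functor_Ob[OF N(1)] functor_Ob[OF N(3)] functor_Ob[OF M'] by auto
    have sm: "small TYPE('u) ?X" "small TYPE('u) ?Y"
      using small by (auto intro!: small_Un[OF u] small_image)
    have Y: "?Y \<subseteq> Ar D" using functor_Ar(1)[OF N(1)] functor_Ar(1)[OF N(3)] functor_Ar(1)[OF M'] by auto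
    have XY: "Dom D ` ?Y \<subseteq> ?X" "Cod D ` ?Y \<subseteq> ?X"
      using functor_Ar(2,3)[OF N(1)] functor_Ar(2,3)[OF N(3)] functor_Ar(2,3)[OF M']
        Dom_Ob[OF small_catD[OF E]] Cod_Ob[OF small_catD[OF E]]
        Dom_Ob[OF small_catD[OF Fib]] Cod_Ob[OF small_catD[OF Fib]] by auto
    have "\<exists>Z. ?Y \<subseteq> Z \<and> Z \<subseteq> Ar D \<and>
        (\<exists>!N. is_functor Fib (D\<lparr>Ob := ?X, Ar := Z\<rparr>) N \<and> comp_func ?E N L = M)"
      by (rule ext[OF X sm(1) _ Y sm(2) _ XY]) (rule le_supI1, rule sup_ge1)+
    then obtain Z where Z: "?Y \<subseteq> Z" "Z \<subseteq> Ar D"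
      "\<exists>!N. is_functor Fib (D\<lparr>Ob := ?X, Ar := Z\<rparr>) N \<and> comp_func ?E N L = M"
      by (elim exE conjE)
    have "is_functor Fib (D\<lparr>Ob := ?X, Ar := Z\<rparr>) N" "is_functor Fib (D\<lparr>Ob := ?X, Ar := Z\<rparr>) N'"
      unfolding functor_subcat_iff[OF X Z(2)] using N Z(1) by auto
    then show ?thesis using Z(3) N by blast
  qed
  ultimately show ?thesis by blast
qed

section \<open>Natural transformations as functors into the arrow category\<close>

text \<open>An arrow is a commutative square from \<open>f\<close> to \<open>g\<close>. It records
  both end points, since the same pair \<open>(a, b)\<close> may form squares between different
  arrows.\<close>

definition arrow_cat :: "('o, 'a) cat \<Rightarrow> ('a, 'a \<times> 'a \<times> 'a \<times> 'a) cat" where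
  "arrow_cat D =
     \<lparr>Ob = Ar D,
      Ar = {(f, a, b, g). f \<in> Ar D \<and> g \<in> Ar D \<and> a \<in> hom D (Dom D f) (Dom D g) \<and>
        b \<in> hom D (Cod D f) (Cod D g) \<and> Comp D g a = Comp D b f},
      Dom = (\<lambda>(f, a, b, g). f),
      Cod = (\<lambda>(f, a, b, g). g),
      Id = (\<lambda>f. (f, Id D (Dom D f), Id D (Cod D f), f)),
      Comp = (\<lambda>(g, a', b', h) (f, a, b, _). (f, Comp D a' a, Comp D b' b, h))\<rparr>"

lemma arrow_cat_hom:
  "s \<in> hom (arrow_cat D) f g \<longleftrightarrow> f \<in> Ar D \<and> g \<in> Ar D \<and> (\<exists>a b. s = (f, a, b, g) \<and>
    a \<in> hom D (Dom D f) (Dom D g) \<and> b \<in> hom D (Cod D f) (Cod D g) \<and> Comp D g a = Comp D b f)"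
  by (auto simp: hom_def arrow_cat_def)

lemma arrow_cat_sel:
  "Ob (arrow_cat D) = Ar D"
  "Dom (arrow_cat D) (f, a, b, g) = f" "Cod (arrow_cat D) (f, a, b, g) = g"
  "Id (arrow_cat D) f = (f, Id D (Dom D f), Id D (Cod D f), f)"
  "Comp (arrow_cat D) (g, a', b', h) (f, a, b, g') = (f, Comp D a' a, Comp D b' b, h)"
  by (simp_all add: arrow_cat_def)

lemma category_arrow_cat:
  assumes D: "category D"
  shows "category (arrow_cat D)"
proof (rule categoryI)
  show "Dom (arrow_cat D) s \<in> Ob (arrow_cat D) \<and> Cod (arrow_cat D) s \<in> Ob (arrow_cat D)"
    if "s \<in> Ar (arrow_cat D)" for s
    using that by (auto simp: arrow_cat_def)
  show "Id (arrow_cat D) f \<in> hom (arrow_cat D) f f" if "f \<in> Ob (arrow_cat D)" for f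
    using that D Ar_hom[of f D] by (auto simp: arrow_cat_hom arrow_cat_sel Dom_Ob Cod_Ob Id_hom
      Comp_Id_left Comp_Id_right)
  show "Comp (arrow_cat D) t s \<in> hom (arrow_cat D) f h"
    if s: "s \<in> hom (arrow_cat D) f g" and t: "t \<in> hom (arrow_cat D) g h" for s t f g h
  proof -
    obtain a b where s': "s = (f, a, b, g)" "f \<in> Ar D" "g \<in> Ar D" "a \<in> hom D (Dom D f) (Dom D g)"
      "b \<in> hom D (Cod D f) (Cod D g)" "Comp D g a = Comp D b f"
      using s by (auto simp: arrow_cat_hom)
    obtain a' b' where t': "t = (g, a', b', h)" "h \<in> Ar D" "a' \<in> hom D (Dom D g) (Dom D h)"
      "b' \<in> hom D (Cod D g) (Cod D h)" "Comp D h a' = Comp D b' g"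
      using t by (auto simp: arrow_cat_hom)
    have "Comp D h (Comp D a' a) = Comp D (Comp D b' g) a"
      using Comp_assoc[OF D Ar_hom[OF t'(2)] t'(3) s'(4)] t'(5) by simp
    also have "\<dots> = Comp D (Comp D b' b) f"
      using Comp_assoc[OF D t'(4) Ar_hom[OF s'(3)] s'(4)] Comp_assoc[OF D t'(4) s'(5) Ar_hom[OF s'(2)]]
        s'(6) by simp
    finally show ?thesis
      using s' t' Comp_hom[OF D t'(3) s'(4)] Comp_hom[OF D t'(4) s'(5)]
      by (simp add: arrow_cat_hom arrow_cat_sel)
  qed
qed (use D in \<open>auto simp: arrow_cat_hom arrow_cat_sel Comp_Id_left Comp_Id_right Comp_assoc\<close>)

definition source_func :: "('o, 'a) cat \<Rightarrow> ('a, 'a \<times> 'a \<times> 'a \<times> 'a, 'o, 'a) func" where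
  "source_func D = \<lparr>omap = restrict (Dom D) (Ar D), amap = (\<lambda>s\<in>Ar (arrow_cat D). fst (snd s))\<rparr>"

definition target_func :: "('o, 'a) cat \<Rightarrow> ('a, 'a \<times> 'a \<times> 'a \<times> 'a, 'o, 'a) func" where
  "target_func D = \<lparr>omap = restrict (Cod D) (Ar D), amap = (\<lambda>s\<in>Ar (arrow_cat D). fst (snd (snd s)))\<rparr>"

lemma source_target_functor:
  assumes D: "category D"
  shows "is_functor (arrow_cat D) D (source_func D)" "is_functor (arrow_cat D) D (target_func D)"
proof -
  have Comp: "Comp (arrow_cat D) t s \<in> Ar (arrow_cat D)"
    if "s \<in> Ar (arrow_cat D)" "t \<in> Ar (arrow_cat D)" "Cod (arrow_cat D) s = Dom (arrow_cat D) t" for s t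
    using Comp_Ar(1)[OF category_arrow_cat[OF D] that] .
  have Id: "Id (arrow_cat D) f \<in> Ar (arrow_cat D)" if "f \<in> Ar D" for f
    using homD(1)[OF Id_hom[OF category_arrow_cat[OF D], of f]] that by (simp add: arrow_cat_sel)
  show "is_functor (arrow_cat D) D (source_func D)"
  proof (rule is_functorI)
    fix s t assume st: "s \<in> Ar (arrow_cat D)" "t \<in> Ar (arrow_cat D)"
      "Cod (arrow_cat D) s = Dom (arrow_cat D) t"
    then show "amap (source_func D) (Comp (arrow_cat D) t s)
        = Comp D (amap (source_func D) t) (amap (source_func D) s)"
      using Comp[OF st] by (auto simp: source_func_def arrow_cat_def)
  qed (use D Id in \<open>auto simp: source_func_def arrow_cat_def Dom_Ob Cod_Ob\<close>)
  show "is_functor (arrow_cat D) D (target_func D)"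
  proof (rule is_functorI)
    fix s t assume st: "s \<in> Ar (arrow_cat D)" "t \<in> Ar (arrow_cat D)"
      "Cod (arrow_cat D) s = Dom (arrow_cat D) t"
    then show "amap (target_func D) (Comp (arrow_cat D) t s)
        = Comp D (amap (target_func D) t) (amap (target_func D) s)"
      using Comp[OF st] by (auto simp: target_func_def arrow_cat_def)
  qed (use D Id in \<open>auto simp: target_func_def arrow_cat_def Dom_Ob Cod_Ob\<close>)
qed

definition trans_func ::
  "('o, 'a) cat \<Rightarrow> ('o, 'a, 'p, 'b) func \<Rightarrow> ('o, 'a, 'p, 'b) func \<Rightarrow> ('o \<Rightarrow> 'b) \<Rightarrow>
    ('o, 'a, 'b, 'b \<times> 'b \<times> 'b \<times> 'b) func" where
  "trans_func C F G \<eta> = \<lparr>omap = restrict \<eta> (Ob C),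
     amap = (\<lambda>f\<in>Ar C. (\<eta> (Dom C f), amap F f, amap G f, \<eta> (Cod C f)))\<rparr>"

lemma nat_transD:
  assumes "nat_trans C D F G \<eta>"
  shows "\<eta> \<in> extensional (Ob C)" "x \<in> Ob C \<Longrightarrow> \<eta> x \<in> hom D (omap F x) (omap G x)"
    "f \<in> Ar C \<Longrightarrow> Comp D (amap G f) (\<eta> (Dom C f)) = Comp D (\<eta> (Cod C f)) (amap F f)"
    "f \<in> hom C x y \<Longrightarrow> Comp D (amap G f) (\<eta> x) = Comp D (\<eta> y) (amap F f)"
  using assms by (auto simp: nat_trans_def hom_def)

lemma trans_func_hom:
  assumes C: "category C" and F: "is_functor C D F" and G: "is_functor C D G"
    and \<eta>: "nat_trans C D F G \<eta>" and f: "f \<in> hom C x y"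
  shows "(\<eta> x, amap F f, amap G f, \<eta> y) \<in> hom (arrow_cat D) (\<eta> x) (\<eta> y)"
  using homD[OF nat_transD(2)[OF \<eta> hom_Ob(1)[OF C f]]] homD[OF nat_transD(2)[OF \<eta> hom_Ob(2)[OF C f]]]
    nat_transD(4)[OF \<eta> f] functor_hom[OF F f] functor_hom[OF G f]
  by (simp add: arrow_cat_hom)

lemma trans_functor:
  assumes C: "category C" and F: "is_functor C D F" and G: "is_functor C D G"
    and \<eta>: "nat_trans C D F G \<eta>"
  shows "is_functor C (arrow_cat D) (trans_func C F G \<eta>)"
    "comp_func C (source_func D) (trans_func C F G \<eta>) = F"
    "comp_func C (target_func D) (trans_func C F G \<eta>) = G"
proof -
  have sq: "(\<eta> (Dom C f), amap F f, amap G f, \<eta> (Cod C f)) \<in> hom (arrow_cat D) (\<eta> (Dom C f)) (\<eta> (Cod C f))"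
    if "f \<in> Ar C" for f
    using trans_func_hom[OF assms Ar_hom[OF that]] .
  have \<eta>': "\<eta> x \<in> Ar D" "Dom D (\<eta> x) = omap F x" "Cod D (\<eta> x) = omap G x" if "x \<in> Ob C" for x
    using homD[OF nat_transD(2)[OF \<eta> that]] by auto
  show "is_functor C (arrow_cat D) (trans_func C F G \<eta>)"
  proof (rule is_functorI)
    fix f g assume "f \<in> Ar C" "g \<in> Ar C" "Cod C f = Dom C g"
    then show "amap (trans_func C F G \<eta>) (Comp C g f)
        = Comp (arrow_cat D) (amap (trans_func C F G \<eta>) g) (amap (trans_func C F G \<eta>) f)"
      using C by (simp add: trans_func_def Comp_Ar arrow_cat_sel functor_Comp_Ar[OF F] functor_Comp_Ar[OF G])
  next
    fix x assume x: "x \<in> Ob C"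
    then show "amap (trans_func C F G \<eta>) (Id C x)
        = Id (arrow_cat D) (omap (trans_func C F G \<eta>) x)"
      using homD[OF Id_hom[OF C x]] \<eta>'[OF x]
      by (simp add: trans_func_def arrow_cat_sel functor_Id[OF F] functor_Id[OF G])
  qed (use sq \<eta>' C in \<open>auto simp: trans_func_def arrow_cat_sel Dom_Ob Cod_Ob\<close>)
  show "comp_func C (source_func D) (trans_func C F G \<eta>) = F"
    using functor_ext[OF F] \<eta>' homD(1)[OF sq] unfolding comp_func_def
    by (auto intro!: func.equality extensionalityI[of _ "Ob C"] extensionalityI[of _ "Ar C"]
      simp: source_func_def trans_func_def)
  show "comp_func C (target_func D) (trans_func C F G \<eta>) = G"
    using functor_ext[OF G] \<eta>' homD(1)[OF sq] unfolding comp_func_def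
    by (auto intro!: func.equality extensionalityI[of _ "Ob C"] extensionalityI[of _ "Ar C"]
      simp: target_func_def trans_func_def)
qed

text \<open>The naturality square at \<open>f\<close> is the commutative square that the arrow
  \<open>amap T f\<close> of \<open>arrow_cat D\<close> consists of. This is the way back from
  \<open>trans_func\<close>.\<close>

lemma functor_arrow_cat_nat_trans:
  assumes C: "category C" and T: "is_functor C (arrow_cat D) T"
  shows "nat_trans C D (comp_func C (source_func D) T) (comp_func C (target_func D) T) (omap T)"
  unfolding nat_trans_def
proof (intro conjI ballI)
  show "omap T \<in> extensional (Ob C)" using functor_ext[OF T] by simp
  show "omap T x \<in> hom D (omap (comp_func C (source_func D) T) x) (omap (comp_func C (target_func D) T) x)"
    if "x \<in> Ob C" for x
    using that functor_Ob[OF T that] by (auto simp: arrow_cat_sel source_func_def target_func_def hom_def)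
  show "Comp D (amap (comp_func C (target_func D) T) f) (omap T (Dom C f))
      = Comp D (omap T (Cod C f)) (amap (comp_func C (source_func D) T) f)" if f: "f \<in> Ar C" for f
    using functor_hom[OF T Ar_hom[OF f]] functor_Ar(1)[OF T f] f
    by (auto simp: arrow_cat_hom source_func_def target_func_def)
qed

text \<open>Lifts in the arrow category are computed on sources and targets separately. That the two
  lifts form a square is tested at a vertex \<open>M y\<close> against the cones of
  \<open>M'\<close>. Such a vertex need not lie in the image of \<open>M'\<close>, hence the
  hypotheses on every object \<open>d\<close>.\<close>

lemma lifting_functor_trans:
  fixes S :: "('u, 'k) sketch" and D :: "('o, 'a) cat"
  assumes S: "limit_sketch S" and D: "category D"
    and M: "is_functor (base S) D M" "\<And>d \<alpha>. d \<in> Ob D \<Longrightarrow> \<alpha> \<in> labels S \<Longrightarrow> unique_lifts D M (cones S \<alpha>) d"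
    and M': "is_functor (base S) D M'" "\<And>d \<alpha>. d \<in> Ob D \<Longrightarrow> \<alpha> \<in> labels S \<Longrightarrow> unique_lifts D M' (cones S \<alpha>) d"
    and \<tau>: "nat_trans (base S) D M M' \<tau>"
  shows "lifting_functor S (arrow_cat D) (trans_func (base S) M M' \<tau>)"
  unfolding lifting_functor_def
proof (intro conjI ballI)
  let ?E = "base S"
  let ?T = "trans_func ?E M M' \<tau>"
  note E = limit_sketchD(1)[OF S]
  show "is_functor ?E (arrow_cat D) ?T" by (rule trans_functor[OF E M(1) M'(1) \<tau>])
  fix y \<alpha> assume y: "y \<in> Ob ?E" and \<alpha>: "\<alpha> \<in> labels S"
  let ?C = "cones S \<alpha>"
  note C = limit_sketchD(2)[OF S \<alpha>]
  note C' = is_coneD[OF C]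
  note legs = cone_legs(1)[OF E C]
  note \<tau>_hom = nat_transD(2)[OF \<tau>]
  have leg_Ar: "legs ?C i \<in> Ar ?E" "Dom ?E (legs ?C i) = vertex ?C"
    "Cod ?E (legs ?C i) = omap (diagram ?C) i" if "i \<in> Ob (index ?C)" for i
    using homD[OF legs[OF that]] by auto
  have T: "omap ?T x = \<tau> x" if "x \<in> Ob ?E" for x
    using that by (simp add: trans_func_def)
  have T_leg: "amap ?T (legs ?C i)
      = (\<tau> (vertex ?C), amap M (legs ?C i), amap M' (legs ?C i), \<tau> (omap (diagram ?C) i))"
    if "i \<in> Ob (index ?C)" for i
    using leg_Ar[OF that] by (simp add: trans_func_def)
  show "unique_lifts (arrow_cat D) ?T ?C (omap ?T y)"
    unfolding unique_lifts_def T[OF y]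
  proof (intro allI impI)
    fix \<psi> assume \<psi>: "cone_over (arrow_cat D) ?T ?C (\<tau> y) \<psi>"
    \<comment> \<open>A leg is a square from \<open>\<tau> y\<close> to \<tau> at the object of the
      diagram. Its upper and lower sides \<open>a i\<close> and \<open>b i\<close> form cones over
      the diagrams in the images of \<open>M\<close> and \<open>M'\<close>.\<close>
    define a b where "a i = fst (snd (\<psi> i))" and "b i = fst (snd (snd (\<psi> i)))" for i
    have \<psi>_eq: "\<psi> i = (\<tau> y, a i, b i, \<tau> (omap (diagram ?C) i))"
      and a: "a i \<in> hom D (omap M y) (omap M (omap (diagram ?C) i))"
      and b: "b i \<in> hom D (omap M' y) (omap M' (omap (diagram ?C) i))"
      and sq: "Comp D (\<tau> (omap (diagram ?C) i)) (a i) = Comp D (b i) (\<tau> y)"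
      if i: "i \<in> Ob (index ?C)" for i
    proof -
      have i': "omap (diagram ?C) i \<in> Ob ?E" using functor_Ob[OF C'(4) i] .
      have "\<psi> i \<in> hom (arrow_cat D) (\<tau> y) (\<tau> (omap (diagram ?C) i))"
        using \<psi> i T[OF i'] unfolding cone_over_def by auto
      then show "\<psi> i = (\<tau> y, a i, b i, \<tau> (omap (diagram ?C) i))"
        "a i \<in> hom D (omap M y) (omap M (omap (diagram ?C) i))"
        "b i \<in> hom D (omap M' y) (omap M' (omap (diagram ?C) i))"
        "Comp D (\<tau> (omap (diagram ?C) i)) (a i) = Comp D (b i) (\<tau> y)"
        using homD[OF \<tau>_hom[OF y]] homD[OF \<tau>_hom[OF i']] by (auto simp: arrow_cat_hom a_def b_def)
    qed
    have nat: "Comp D (amap M (amap (diagram ?C) j)) (a (Dom (index ?C) j)) = a (Cod (index ?C) j) \<and>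
        Comp D (amap M' (amap (diagram ?C) j)) (b (Dom (index ?C) j)) = b (Cod (index ?C) j)"
      if j: "j \<in> Ar (index ?C)" for j
    proof -
      have "Comp (arrow_cat D) (amap ?T (amap (diagram ?C) j)) (\<psi> (Dom (index ?C) j)) = \<psi> (Cod (index ?C) j)"
        using \<psi> j unfolding cone_over_def by auto
      then show ?thesis
        using functor_Ar[OF C'(4) j] \<psi>_eq[OF Dom_Ob[OF C'(3) j]] \<psi>_eq[OF Cod_Ob[OF C'(3) j]]
        by (simp add: trans_func_def arrow_cat_sel)
    qed
    have My: "omap M y \<in> Ob D" "omap M' y \<in> Ob D" using functor_Ob[OF M(1) y] functor_Ob[OF M'(1) y] .
    have "cone_over D M ?C (omap M y) a" "cone_over D M' ?C (omap M' y) b"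
      using a b nat by (auto simp: cone_over_def)
    then have ex: "\<exists>!u. is_lift D M ?C (omap M y) a u" "\<exists>!v. is_lift D M' ?C (omap M' y) b v"
      using M(2)[OF My(1) \<alpha>] M'(2)[OF My(2) \<alpha>] unfolding unique_lifts_def by blast+
    then obtain u v where u: "is_lift D M ?C (omap M y) a u" and v: "is_lift D M' ?C (omap M' y) b v"
      by blast
    have u': "u \<in> hom D (omap M y) (omap M (vertex ?C))"
      "\<And>i. i \<in> Ob (index ?C) \<Longrightarrow> Comp D (amap M (legs ?C i)) u = a i"
      using u by (auto simp: is_lift_def)
    have v': "v \<in> hom D (omap M' y) (omap M' (vertex ?C))"
      "\<And>i. i \<in> Ob (index ?C) \<Longrightarrow> Comp D (amap M' (legs ?C i)) v = b i"
      using v by (auto simp: is_lift_def)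
    \<comment> \<open>Both composites run from \<open>M y\<close> to the vertex of the limit cone
      for \<open>M'\<close>. Naturality of \<tau> at the legs shows that they agree after each leg,
      so they are lifts of one cone.\<close>
    have square: "Comp D (\<tau> (vertex ?C)) u = Comp D v (\<tau> y)"
    proof -
      let ?\<chi> = "\<lambda>i. Comp D (amap M' (legs ?C i)) (Comp D v (\<tau> y))"
      have v\<tau>: "Comp D v (\<tau> y) \<in> hom D (omap M y) (omap M' (vertex ?C))"
        using Comp_hom[OF D v'(1) \<tau>_hom[OF y]] .
      then have "\<exists>!w. is_lift D M' ?C (omap M y) ?\<chi> w"
        using M'(2)[OF My(1) \<alpha>] cone_over_lift[OF D E M'(1) C v\<tau>] unfolding unique_lifts_def by blast
      moreover have "is_lift D M' ?C (omap M y) ?\<chi> (Comp D v (\<tau> y))"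
        using v\<tau> by (simp add: is_lift_def)
      moreover have "is_lift D M' ?C (omap M y) ?\<chi> (Comp D (\<tau> (vertex ?C)) u)"
        unfolding is_lift_def
      proof (intro conjI ballI)
        show "Comp D (\<tau> (vertex ?C)) u \<in> hom D (omap M y) (omap M' (vertex ?C))"
          using Comp_hom[OF D \<tau>_hom[OF C'(1)] u'(1)] .
        fix i assume i: "i \<in> Ob (index ?C)"
        have i': "omap (diagram ?C) i \<in> Ob ?E" using functor_Ob[OF C'(4) i] .
        have "Comp D (amap M' (legs ?C i)) (Comp D (\<tau> (vertex ?C)) u)
            = Comp D (Comp D (amap M' (legs ?C i)) (\<tau> (vertex ?C))) u"
          using Comp_assoc[OF D functor_hom[OF M'(1) legs[OF i]] \<tau>_hom[OF C'(1)] u'(1)] by simp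
        also have "\<dots> = Comp D (Comp D (\<tau> (omap (diagram ?C) i)) (amap M (legs ?C i))) u"
          using nat_transD(4)[OF \<tau> legs[OF i]] by simp
        also have "\<dots> = Comp D (b i) (\<tau> y)"
          using Comp_assoc[OF D \<tau>_hom[OF i'] functor_hom[OF M(1) legs[OF i]] u'(1)] u'(2)[OF i] sq[OF i]
          by simp
        also have "\<dots> = ?\<chi> i"
          using Comp_assoc[OF D functor_hom[OF M'(1) legs[OF i]] v'(1) \<tau>_hom[OF y]] v'(2)[OF i] by simp
        finally show "Comp D (amap M' (legs ?C i)) (Comp D (\<tau> (vertex ?C)) u) = ?\<chi> i" .
      qed
      ultimately show ?thesis by blast
    qed
    show "\<exists>!s. is_lift (arrow_cat D) ?T ?C (\<tau> y) \<psi> s"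
    proof (rule ex1I)
      show "is_lift (arrow_cat D) ?T ?C (\<tau> y) \<psi> (\<tau> y, u, v, \<tau> (vertex ?C))"
        unfolding is_lift_def T[OF C'(1)]
        using homD[OF \<tau>_hom[OF y]] homD[OF \<tau>_hom[OF C'(1)]] u' v' square \<psi>_eq
        by (simp add: arrow_cat_hom arrow_cat_sel T_leg)
      fix s assume s: "is_lift (arrow_cat D) ?T ?C (\<tau> y) \<psi> s"
      then obtain u1 v1 where s': "s = (\<tau> y, u1, v1, \<tau> (vertex ?C))"
        "u1 \<in> hom D (omap M y) (omap M (vertex ?C))" "v1 \<in> hom D (omap M' y) (omap M' (vertex ?C))"
        using homD[OF \<tau>_hom[OF y]] homD[OF \<tau>_hom[OF C'(1)]]
        unfolding is_lift_def T[OF C'(1)] by (auto simp: arrow_cat_hom)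
      have "Comp D (amap M (legs ?C i)) u1 = a i \<and> Comp D (amap M' (legs ?C i)) v1 = b i"
        if i: "i \<in> Ob (index ?C)" for i
        using s i \<psi>_eq[OF i] T_leg[OF i] unfolding is_lift_def s'(1) by (auto simp: arrow_cat_sel)
      then have "is_lift D M ?C (omap M y) a u1" "is_lift D M' ?C (omap M' y) b v1"
        using s' by (auto simp: is_lift_def)
      then show "s = (\<tau> y, u, v, \<tau> (vertex ?C))"
        using ex u v s'(1) by blast
    qed
  qed
qed

section \<open>Models and equivalences\<close>

lemma whisker_nat_trans:
  assumes C: "category C" and F: "is_functor C D F" and \<eta>: "nat_trans D K N N' \<eta>"
  shows "nat_trans C K (comp_func C N F) (comp_func C N' F) (\<lambda>x\<in>Ob C. \<eta> (omap F x))"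
  using nat_transD(2)[OF \<eta> functor_Ob[OF F]] nat_transD(4)[OF \<eta> functor_hom[OF F Ar_hom]]
  by (simp add: nat_trans_def Dom_Ob[OF C] Cod_Ob[OF C])

text \<open>A transformation is a functor into \<open>arrow_cat D\<close>, so
  \<open>extension\<close> is used three times: in \<open>arrow_cat D\<close> to extend \<tau>, and
  in \<open>D\<close> to identify the source and target of the result.\<close>

lemma nat_trans_extension:
  fixes S :: "('u, 'k) sketch" and D :: "('o, 'a) cat"
  assumes u: "universe TYPE('u)" and S: "limit_sketch S" and fact: "bang_factorization S Fib L"
    and D: "category D"
    and N: "is_functor Fib D N" "is_functor Fib D N'"
    and M: "\<And>d \<alpha>. d \<in> Ob D \<Longrightarrow> \<alpha> \<in> labels S \<Longrightarrow> unique_lifts D (comp_func (base S) N L) (cones S \<alpha>) d"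
    and M': "\<And>d \<alpha>. d \<in> Ob D \<Longrightarrow> \<alpha> \<in> labels S \<Longrightarrow> unique_lifts D (comp_func (base S) N' L) (cones S \<alpha>) d"
    and \<tau>: "nat_trans (base S) D (comp_func (base S) N L) (comp_func (base S) N' L) \<tau>"
  shows "\<exists>!\<sigma>. nat_trans Fib D N N' \<sigma> \<and> (\<lambda>x\<in>Ob (base S). \<sigma> (omap L x)) = \<tau>"
proof -
  let ?E = "base S"
  let ?NL = "comp_func ?E N L" and ?NL' = "comp_func ?E N' L"
  let ?T = "trans_func ?E ?NL ?NL' \<tau>"
  note E = limit_sketchD(1)[OF S]
  note Fib = small_catD[OF bang_factorizationD(1)[OF S fact]]
  note L = bang_factorizationD(2)[OF S fact]
  note NL = comp_functor[OF E L N(1)] and NL' = comp_functor[OF E L N(2)]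
  note T = trans_functor[OF E NL NL' \<tau>]
  note st = source_target_functor[OF D]
  have "\<exists>!W. is_functor Fib (arrow_cat D) W \<and> comp_func ?E W L = ?T"
    using extension[OF u S fact category_arrow_cat[OF D] lifting_functor_trans[OF S D NL M NL' M' \<tau>]] .
  then obtain W where W: "is_functor Fib (arrow_cat D) W" "comp_func ?E W L = ?T"
    and unique: "\<And>W'. is_functor Fib (arrow_cat D) W' \<Longrightarrow> comp_func ?E W' L = ?T \<Longrightarrow> W' = W"
    by blast
  have lifting: "lifting_functor S D ?NL" "lifting_functor S D ?NL'"
    using M M' NL NL' functor_Ob[OF NL] functor_Ob[OF NL'] by (auto simp: lifting_functor_def)
  have "comp_func ?E (comp_func Fib (source_func D) W) L = ?NL"
    "comp_func ?E (comp_func Fib (target_func D) W) L = ?NL'"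
    by (simp_all add: comp_func_assoc[OF L] W(2) T(2,3))
  \<comment> \<open>The source of \<open>W\<close> and \<open>N\<close> are both extensions of
    \<open>N L\<close>, hence equal; in the same way its target is \<open>N'\<close>. Only now is
    \<open>omap W\<close> known to be a transformation from \<open>N\<close> to
    \<open>N'\<close>.\<close>
  then have W_st: "comp_func Fib (source_func D) W = N" "comp_func Fib (target_func D) W = N'"
    using extension[OF u S fact D lifting(1)] extension[OF u S fact D lifting(2)] N
      comp_functor[OF Fib W(1) st(1)] comp_functor[OF Fib W(1) st(2)] by blast+
  have "\<tau> x = omap W (omap L x)" if "x \<in> Ob ?E" for x
    using arg_cong[OF W(2), of "\<lambda>F. omap F x"] that by (simp add: trans_func_def)
  then have "(\<lambda>x\<in>Ob ?E. omap W (omap L x)) = \<tau>"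
    using nat_transD(1)[OF \<tau>] by (intro extensionalityI[of _ "Ob ?E"]) auto
  moreover have "nat_trans Fib D N N' (omap W)"
    using functor_arrow_cat_nat_trans[OF Fib W(1)] unfolding W_st .
  moreover have "\<sigma> = omap W"
    if \<sigma>: "nat_trans Fib D N N' \<sigma>" "(\<lambda>x\<in>Ob ?E. \<sigma> (omap L x)) = \<tau>" for \<sigma>
  proof -
    let ?V = "trans_func Fib N N' \<sigma>"
    have \<sigma>L: "\<sigma> (omap L x) = \<tau> x" if "x \<in> Ob ?E" for x
      using fun_cong[OF \<sigma>(2), of x] that by simp
    have "?V = W"
    proof (rule unique)
      show V: "is_functor Fib (arrow_cat D) ?V" by (rule trans_functor[OF Fib N \<sigma>(1)])
      show "comp_func ?E ?V L = ?T"
        by (rule functor_eqI[OF comp_functor[OF E L V] T(1)])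
          (simp_all add: trans_func_def \<sigma>L functor_Ob[OF L] functor_Ar[OF L] Dom_Ob[OF E] Cod_Ob[OF E])
    qed
    then have "omap W = restrict \<sigma> (Ob Fib)" by (auto simp: trans_func_def)
    then show ?thesis using nat_transD(1)[OF \<sigma>(1)] by (simp add: extensional_restrict)
  qed
  ultimately show ?thesis by blast
qed

lemma category_functor_cat:
  assumes C: "category C" and D: "category D"
  shows "category (functor_cat C D)"
proof (rule categoryI)
  let ?K = "functor_cat C D"
  have hom: "m \<in> hom ?K F G \<longleftrightarrow> (\<exists>\<eta>. m = (F, G, \<eta>) \<and> is_functor C D F \<and> is_functor C D G \<and>
      nat_trans C D F G \<eta>)" for m F G
    by (auto simp: functor_cat_def hom_def)
  show "Dom ?K m \<in> Ob ?K \<and> Cod ?K m \<in> Ob ?K" if "m \<in> Ar ?K" for m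
    using that by (auto simp: functor_cat_def)
  show "Id ?K F \<in> hom ?K F F" if "F \<in> Ob ?K" for F
  proof -
    have F: "is_functor C D F" using that by (simp add: functor_cat_def)
    have "nat_trans C D F F (\<lambda>x\<in>Ob C. Id D (omap F x))"
      using functor_Ob[OF F] Id_hom[OF D] Dom_Ob[OF C] Cod_Ob[OF C]
        Comp_Id_left[OF D functor_hom[OF F Ar_hom]] Comp_Id_right[OF D functor_hom[OF F Ar_hom]]
      by (simp add: nat_trans_def)
    then show ?thesis using F by (simp add: hom) (simp add: functor_cat_def)
  qed
  show "Comp ?K n m \<in> hom ?K F H" if m: "m \<in> hom ?K F G" and n: "n \<in> hom ?K G H" for m n F G H
  proof -
    obtain \<eta> where \<eta>: "m = (F, G, \<eta>)" "is_functor C D F" "is_functor C D G" "nat_trans C D F G \<eta>"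
      using m by (auto simp: hom)
    obtain \<theta> where \<theta>: "n = (G, H, \<theta>)" "is_functor C D H" "nat_trans C D G H \<theta>"
      using n by (auto simp: hom)
    note hom_\<eta> = nat_transD(2)[OF \<eta>(4)] and hom_\<theta> = nat_transD(2)[OF \<theta>(3)]
    have "nat_trans C D F H (\<lambda>x\<in>Ob C. Comp D (\<theta> x) (\<eta> x))"
      unfolding nat_trans_def
    proof (intro conjI ballI)
      fix f assume f: "f \<in> Ar C"
      note xy = Dom_Ob[OF C f] Cod_Ob[OF C f]
      note Ff = functor_hom[OF \<eta>(2) Ar_hom[OF f]] and Gf = functor_hom[OF \<eta>(3) Ar_hom[OF f]]
        and Hf = functor_hom[OF \<theta>(2) Ar_hom[OF f]]
      show "Comp D (amap H f) ((\<lambda>x\<in>Ob C. Comp D (\<theta> x) (\<eta> x)) (Dom C f))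
          = Comp D ((\<lambda>x\<in>Ob C. Comp D (\<theta> x) (\<eta> x)) (Cod C f)) (amap F f)"
        using xy nat_transD(3)[OF \<eta>(4) f] nat_transD(3)[OF \<theta>(3) f]
          Comp_assoc[OF D Hf hom_\<theta>[OF xy(1)] hom_\<eta>[OF xy(1)]]
          Comp_assoc[OF D hom_\<theta>[OF xy(2)] Gf hom_\<eta>[OF xy(1)]]
          Comp_assoc[OF D hom_\<theta>[OF xy(2)] hom_\<eta>[OF xy(2)] Ff]
        by simp
    qed (use Comp_hom[OF D hom_\<theta> hom_\<eta>] in auto)
    then show ?thesis using \<eta> \<theta> by (simp add: hom) (simp add: functor_cat_def)
  qed
  show "Comp ?K m (Id ?K F) = m" "Comp ?K (Id ?K G) m = m" if m: "m \<in> hom ?K F G" for m F G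
  proof -
    obtain \<eta> where \<eta>: "m = (F, G, \<eta>)" "nat_trans C D F G \<eta>" using m by (auto simp: hom)
    show "Comp ?K m (Id ?K F) = m" "Comp ?K (Id ?K G) m = m"
      using nat_transD(1)[OF \<eta>(2)] Comp_Id_left[OF D nat_transD(2)[OF \<eta>(2)]]
        Comp_Id_right[OF D nat_transD(2)[OF \<eta>(2)]]
      by (auto simp: functor_cat_def \<eta>(1) intro!: extensionalityI[of _ "Ob C"])
  qed
  show "Comp ?K n (Comp ?K m l) = Comp ?K (Comp ?K n m) l"
    if "l \<in> hom ?K F G" "m \<in> hom ?K G H" "n \<in> hom ?K H I" for l m n F G H I
  proof -
    obtain \<eta> \<theta> \<zeta> where lmn: "l = (F, G, \<eta>)" "m = (G, H, \<theta>)" "n = (H, I, \<zeta>)"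
      and nat: "nat_trans C D F G \<eta>" "nat_trans C D G H \<theta>" "nat_trans C D H I \<zeta>"
      using \<open>l \<in> _\<close> \<open>m \<in> _\<close> \<open>n \<in> _\<close> unfolding hom by blast
    show ?thesis
      using Comp_assoc[OF D nat_transD(2)[OF nat(3)] nat_transD(2)[OF nat(2)] nat_transD(2)[OF nat(1)]]
      by (auto simp: functor_cat_def lmn intro!: restrict_ext)
  qed
qed

lemma category_full_subcat:
  assumes "category C"
  shows "category (full_subcat C X)"
proof -
  have hom: "hom (full_subcat C X) x y = {f \<in> hom C x y. x \<in> X \<and> y \<in> X}" for x y
    by (auto simp: full_subcat_def hom_def)
  show ?thesis
    by (rule categoryI) (use assms in \<open>auto simp: hom Id_hom Comp_hom Comp_Id_left Comp_Id_right Comp_assoc\<close>,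
      use assms in \<open>auto simp: full_subcat_def Dom_Ob Cod_Ob Id_hom Comp_hom Comp_Id_left Comp_Id_right Comp_assoc\<close>)
qed

lemma id_nat_iso:
  assumes C: "category C" and D: "category D" and F: "is_functor C D F"
  shows "nat_iso C D F F (\<lambda>x\<in>Ob C. Id D (omap F x))"
proof -
  have "(F, F, \<lambda>x\<in>Ob C. Id D (omap F x)) \<in> hom (functor_cat C D) F F"
    using Id_hom[OF category_functor_cat[OF C D], of F] F by (simp add: functor_cat_def)
  then have "nat_trans C D F F (\<lambda>x\<in>Ob C. Id D (omap F x))"
    by (simp add: functor_cat_def hom_def)
  moreover have "is_iso D (Id D x)" if "x \<in> Ob D" for x
    using Id_hom[OF D that] Comp_Id_left[OF D Id_hom[OF D that]]
    unfolding is_iso_def by (auto simp: hom_def)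
  ultimately show ?thesis using functor_Ob[OF F] by (simp add: nat_iso_def)
qed

text \<open>Inverting the object and arrow maps gives a strict inverse functor, so unit and counit
  can be taken to be identities.\<close>

lemma is_equivalence_if_bij:
  assumes C: "category C" and D: "category D" and F: "is_functor C D F"
    and ob: "bij_betw (omap F) (Ob C) (Ob D)" and ar: "bij_betw (amap F) (Ar C) (Ar D)"
  shows "is_equivalence C D F"
proof -
  define io ia where "io = inv_into (Ob C) (omap F)" and "ia = inv_into (Ar C) (amap F)"
  have io: "x \<in> Ob C \<Longrightarrow> io (omap F x) = x" "y \<in> Ob D \<Longrightarrow> io y \<in> Ob C \<and> omap F (io y) = y" for x y
    using ob by (auto simp: io_def bij_betw_def f_inv_into_f inv_into_into)
  have ia: "f \<in> Ar C \<Longrightarrow> ia (amap F f) = f" "g \<in> Ar D \<Longrightarrow> ia g \<in> Ar C \<and> amap F (ia g) = g" for f g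
    using ar by (auto simp: ia_def bij_betw_def f_inv_into_f inv_into_into)
  define G where "G = \<lparr>omap = restrict io (Ob D), amap = restrict ia (Ar D)\<rparr>"
  \<comment> \<open>\<open>F\<close> determines only the images of the end points of
    \<open>ia g\<close>; applying \<open>io\<close> recovers the end points themselves.\<close>
  have Dom: "Dom C (ia g) = io (Dom D g)" "Cod C (ia g) = io (Cod D g)" if "g \<in> Ar D" for g
    using functor_Ar(2,3)[OF F, of "ia g"] ia(2)[OF that] io(1) Dom_Ob[OF C] Cod_Ob[OF C] by metis+
  have G: "is_functor D C G"
  proof (rule is_functorI)
    fix y assume y: "y \<in> Ob D"
    then have "ia (amap F (Id C (io y))) = Id C (io y)"
      using io(2) ia(1) homD(1)[OF Id_hom[OF C]] by blast
    then show "amap G (Id D y) = Id C (omap G y)"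
      using y io(2)[OF y] functor_Id[OF F, of "io y"] homD(1)[OF Id_hom[OF D y]] by (simp add: G_def)
  next
    fix f g assume fg: "f \<in> Ar D" "g \<in> Ar D" "Cod D f = Dom D g"
    then have "Cod C (ia f) = Dom C (ia g)" by (simp add: Dom)
    then have "amap F (Comp C (ia g) (ia f)) = Comp D g f" "Comp C (ia g) (ia f) \<in> Ar C"
      using ia(2) fg Comp_Ar(1)[OF C] functor_Comp_Ar[OF F] by simp_all
    then have "ia (Comp D g f) = Comp C (ia g) (ia f)"
      using ia(1) by metis
    then show "amap G (Comp D g f) = Comp C (amap G g) (amap G f)"
      using fg Comp_Ar(1)[OF D fg] by (simp add: G_def)
  qed (use io ia Dom Dom_Ob[OF D] Cod_Ob[OF D] in \<open>auto simp: G_def hom_def\<close>)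
  have "comp_func C G F = id_func C"
    using io ia functor_Ob[OF F] functor_Ar(1)[OF F]
    by (auto simp: comp_func_def id_func_def G_def intro!: restrict_ext)
  moreover have "comp_func D F G = id_func D"
    using io ia by (auto simp: comp_func_def id_func_def G_def intro!: restrict_ext)
  ultimately show ?thesis
    unfolding is_equivalence_def
    using F G id_nat_iso[OF C C id_functor[OF C]] id_nat_iso[OF D D id_functor[OF D]] by metis
qed

section \<open>Categories of models and restriction along \<open>L\<close>\<close>

lemma Mod_Ob: "M \<in> Ob (Mod S D) \<longleftrightarrow>
    is_functor (base S) D M \<and> (\<forall>\<alpha>\<in>labels S. limit_cone D (map_cone M (cones S \<alpha>)))"
  by (simp add: Mod_def full_subcat_def functor_cat_def)

lemma Mod_Ar: "m \<in> Ar (Mod S D) \<longleftrightarrow> (\<exists>M M' \<eta>. m = (M, M', \<eta>) \<and> M \<in> Ob (Mod S D) \<and>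
    M' \<in> Ob (Mod S D) \<and> nat_trans (base S) D M M' \<eta>)"
  by (auto simp: Mod_def full_subcat_def functor_cat_def)

lemma Mod_sel:
  "Dom (Mod S D) (M, M', \<eta>) = M" "Cod (Mod S D) (M, M', \<eta>) = M'"
  "Id (Mod S D) M = (M, M, \<lambda>x\<in>Ob (base S). Id D (omap M x))"
  "Comp (Mod S D) (M', M'', \<theta>) (M, M', \<eta>) = (M, M'', \<lambda>x\<in>Ob (base S). Comp D (\<theta> x) (\<eta> x))"
  by (simp_all add: Mod_def full_subcat_def functor_cat_def)

lemma category_Mod: "category (base S) \<Longrightarrow> category D \<Longrightarrow> category (Mod S D)"
  unfolding Mod_def by (intro category_full_subcat category_functor_cat)

lemma map_cone_comp:
  assumes "category E" "is_cone E C"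
  shows "map_cone (comp_func E N L) C = map_cone N (map_cone L C)"
  using functor_Ob[OF is_coneD(4)[OF assms(2)]] functor_Ar(1)[OF is_coneD(4)[OF assms(2)]]
    is_coneD(1)[OF assms(2)] homD(1)[OF cone_legs(1)[OF assms]]
  by (auto simp: map_cone_def comp_func_def whisker_def intro!: restrict_ext)

lemma precomp_functor:
  assumes S: "category (base S)" "category (base S')" "category D" and F: "is_functor (base S) (base S') F"
    and models: "\<And>N. N \<in> Ob (Mod S' D) \<Longrightarrow> comp_func (base S) N F \<in> Ob (Mod S D)"
  shows "is_functor (Mod S' D) (Mod S D) (precomp S S' F D)"
proof (rule is_functorI)
  let ?P = "precomp S S' F D"
  have arr: "amap ?P m \<in> hom (Mod S D) (omap ?P (Dom (Mod S' D) m)) (omap ?P (Cod (Mod S' D) m))"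
    if "m \<in> Ar (Mod S' D)" for m
    using that whisker_nat_trans[OF S(1) F] models
    by (auto simp: precomp_def Mod_Ar Mod_sel hom_def)
  then show "amap ?P m \<in> hom (Mod S D) (omap ?P (Dom (Mod S' D) m)) (omap ?P (Cod (Mod S' D) m))"
    if "m \<in> Ar (Mod S' D)" for m using that .
  show "amap ?P (Id (Mod S' D) N) = Id (Mod S D) (omap ?P N)" if N: "N \<in> Ob (Mod S' D)" for N
    using N homD(1)[OF Id_hom[OF category_Mod[OF S(2,3)] N]] functor_Ob[OF F]
    by (auto simp: precomp_def Mod_sel intro!: restrict_ext)
  show "amap ?P (Comp (Mod S' D) n m) = Comp (Mod S D) (amap ?P n) (amap ?P m)"
    if "m \<in> Ar (Mod S' D)" "n \<in> Ar (Mod S' D)" "Cod (Mod S' D) m = Dom (Mod S' D) n" for m n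
    using that Comp_Ar(1)[OF category_Mod[OF S(2,3)] that] functor_Ob[OF F]
    by (auto simp: precomp_def Mod_sel Mod_Ar intro!: restrict_ext)
qed (use models in \<open>auto simp: precomp_def\<close>)

theorem lemma7p4:
  fixes S :: "('u, 'k) sketch"
    and Fib :: "('u, 'u) cat"
    and L :: "('u, 'u, 'u, 'u) func"
  assumes "universe TYPE('u)"
    and "limit_sketch S"
    and "bang_factorization S Fib L"
  shows "morita_equivalence TYPE('o) TYPE('a) S (Fr S Fib L) L id"
proof -
  let ?E = "base S" and ?S' = "Fr S Fib L"
  note E = limit_sketchD[OF assms(2)]
  note Fib = bang_factorizationD(1)[OF assms(2,3)] and L = bang_factorizationD(2)[OF assms(2,3)]
  have Fr: "base ?S' = Fib" "labels ?S' = labels S" "cones ?S' \<alpha> = map_cone L (cones S \<alpha>)" for \<alpha>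
    by (simp_all add: Fr_def)
  have "limit_sketch ?S'"
    using assms(2) Fib is_cone_map[OF small_catD[OF Fib] E(1) L E(2)]
    by (simp add: limit_sketch_def Fr)
  then have "sketch_morphism S ?S' L id"
    using assms(2) L by (simp add: sketch_morphism_def Fr)
  moreover have "is_equivalence (Mod ?S' D) (Mod S D) (precomp S ?S' L D)"
    if "complete_cat TYPE('u) D" for D :: "('o, 'a) cat"
  proof -
    let ?P = "precomp S ?S' L D"
    have D: "category D" using that by (simp add: complete_cat_def)
    \<comment> \<open>A cone of \<open>Fr\<close> is the image under \<open>L\<close> of a cone of
      \<open>S\<close>, and \<open>N\<close> sends it to the image of the latter under
      \<open>N L\<close>. The two limit conditions are thus literally the same.\<close>
    have model_iff: "N \<in> Ob (Mod ?S' D) \<longleftrightarrow> is_functor Fib D N \<and> comp_func ?E N L \<in> Ob (Mod S D)" for N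
      using comp_functor[OF E(1) L, of D N] by (auto simp: Mod_Ob Fr map_cone_comp[OF E(1) E(2)])
    have lifts: "unique_lifts D M (cones S \<alpha>) d"
      if "M \<in> Ob (Mod S D)" "\<alpha> \<in> labels S" "d \<in> Ob D" for M \<alpha> d
      using that limit_cone_map_iff[OF D E(1) _ E(2)] by (auto simp: Mod_Ob)
    then have ext: "\<exists>!N. is_functor Fib D N \<and> comp_func ?E N L = M" if "M \<in> Ob (Mod S D)" for M
      using that functor_Ob[of ?E D M]
      by (intro extension[OF assms D]) (auto simp: lifting_functor_def Mod_Ob)
    have P: "is_functor (Mod ?S' D) (Mod S D) ?P"
      using E(1) small_catD[OF Fib] D L model_iff by (intro precomp_functor) (auto simp: Fr)
    have P_Ob: "omap ?P N = comp_func ?E N L" if "N \<in> Ob (Mod ?S' D)" for N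
      using that by (simp add: precomp_def)
    have P_Ar: "amap ?P (N, N', \<eta>) = (comp_func ?E N L, comp_func ?E N' L, \<lambda>x\<in>Ob ?E. \<eta> (omap L x))"
      if "(N, N', \<eta>) \<in> Ar (Mod ?S' D)" for N N' \<eta>
      using that by (simp add: precomp_def)
    have inj: "N = N'" if "N \<in> Ob (Mod ?S' D)" "N' \<in> Ob (Mod ?S' D)" "comp_func ?E N L = comp_func ?E N' L"
      for N N'
      using that ext[of "comp_func ?E N L"] unfolding model_iff by metis
    have surj: "\<exists>N\<in>Ob (Mod ?S' D). M = comp_func ?E N L" if M: "M \<in> Ob (Mod S D)" for M
      using ext[OF M] M model_iff by blast
    have bij_Ob: "bij_betw (omap ?P) (Ob (Mod ?S' D)) (Ob (Mod S D))"
    proof (rule bij_betw_imageI)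
      show "inj_on (omap ?P) (Ob (Mod ?S' D))"
        using inj P_Ob by (auto intro!: inj_onI)
      have "M \<in> omap ?P ` Ob (Mod ?S' D)" if M: "M \<in> Ob (Mod S D)" for M
        using surj[OF M] P_Ob by force
      then show "omap ?P ` Ob (Mod ?S' D) = Ob (Mod S D)"
        using functor_Ob[OF P] by blast
    qed
    have ext_Ar: "\<exists>!\<sigma>. nat_trans Fib D N N' \<sigma> \<and> (\<lambda>x\<in>Ob ?E. \<sigma> (omap L x)) = \<tau>"
      if "N \<in> Ob (Mod ?S' D)" "N' \<in> Ob (Mod ?S' D)"
        "nat_trans ?E D (comp_func ?E N L) (comp_func ?E N' L) \<tau>" for N N' \<tau>
      using that lifts unfolding model_iff by (intro nat_trans_extension[OF assms D]) auto
    have "bij_betw (amap ?P) (Ar (Mod ?S' D)) (Ar (Mod S D))"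
    proof (rule bij_betw_imageI)
      show "inj_on (amap ?P) (Ar (Mod ?S' D))"
      proof (rule inj_onI)
        fix m n assume m: "m \<in> Ar (Mod ?S' D)" and n: "n \<in> Ar (Mod ?S' D)"
          and eq: "amap ?P m = amap ?P n"
        obtain N N' \<eta> where m': "m = (N, N', \<eta>)" "N \<in> Ob (Mod ?S' D)" "N' \<in> Ob (Mod ?S' D)"
          "nat_trans Fib D N N' \<eta>"
          using m unfolding Mod_Ar Fr by blast
        obtain K K' \<theta> where n': "n = (K, K', \<theta>)" "K \<in> Ob (Mod ?S' D)" "K' \<in> Ob (Mod ?S' D)"
          "nat_trans Fib D K K' \<theta>"
          using n unfolding Mod_Ar Fr by blast
        have eq': "comp_func ?E N L = comp_func ?E K L" "comp_func ?E N' L = comp_func ?E K' L"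
          "(\<lambda>x\<in>Ob ?E. \<eta> (omap L x)) = (\<lambda>x\<in>Ob ?E. \<theta> (omap L x))"
          using eq P_Ar m n m'(1) n'(1) by simp_all
        \<comment> \<open>Arrows of \<open>Mod\<close> carry their end points. Injectivity on
          objects must identify these before the uniqueness in \<open>ext_Ar\<close> can compare the
          transformations.\<close>
        have NK: "N = K" "N' = K'" using inj[OF m'(2) n'(2) eq'(1)] inj[OF m'(3) n'(3) eq'(2)] .
        have "nat_trans Fib D N N' \<theta>" using n'(4) unfolding NK .
        then have "\<eta> = \<theta>"
          using ext_Ar[OF m'(2,3) whisker_nat_trans[OF E(1) L m'(4)]] m'(4) eq'(3)[symmetric] by blast
        then show "m = n" unfolding m'(1) n'(1) NK by simp
      qed
      have "m \<in> amap ?P ` Ar (Mod ?S' D)" if m0: "m \<in> Ar (Mod S D)" for m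
      proof -
        obtain M M' \<tau> where m: "m = (M, M', \<tau>)" "M \<in> Ob (Mod S D)" "M' \<in> Ob (Mod S D)"
          "nat_trans ?E D M M' \<tau>"
          using m0 unfolding Mod_Ar by blast
        obtain N N' where N: "N \<in> Ob (Mod ?S' D)" "M = comp_func ?E N L"
            "N' \<in> Ob (Mod ?S' D)" "M' = comp_func ?E N' L"
          using surj[OF m(2)] surj[OF m(3)] by blast
        then obtain \<sigma> where \<sigma>: "nat_trans Fib D N N' \<sigma>" "(\<lambda>x\<in>Ob ?E. \<sigma> (omap L x)) = \<tau>"
          using ext_Ar[OF N(1,3)] m(4) by blast
        then have "(N, N', \<sigma>) \<in> Ar (Mod ?S' D)" using N by (simp add: Mod_Ar Fr)
        then show ?thesis using P_Ar[of N N' \<sigma>] \<sigma>(2) N m(1) by force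
      qed
      then show "amap ?P ` Ar (Mod ?S' D) = Ar (Mod S D)"
        using functor_Ar(1)[OF P] by blast
    qed
    then show ?thesis
      using E(1) small_catD[OF Fib] D by (intro is_equivalence_if_bij P bij_Ob category_Mod) (auto simp: Fr)
  qed
  ultimately show ?thesis by (simp add: morita_equivalence_def)
qed

end
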